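(* Let $\{p_\theta:\theta\in\Theta\}$, $\Theta\subseteq\mathbb{R}$, be a family of probability densities such that for every $\theta\in\Theta$: the score $s(\theta,y)=\partial\log p_\theta(y)/\partial\theta$ exists and is finite, $E_\theta\{s(\theta,Y)\}=0$, $\mathcal{I}(\theta)=E_\theta\{s(\theta,Y)^2\}<\infty$, $\mathcal{I}(\cdot)$ is continuous at $\theta$, and $\mathcal{I}(\theta)>0$. Let $\theta^*\in\Theta$. Suppose that $\theta\mapsto\mathcal{I}(\theta)^{-1}$ is continuously differentiable in a neighbourhood of $\theta^*$, and that there exist non-negative constants $B,C<\infty$ such that, with $Z(\theta,Y)=\mathcal{I}(\theta)^{-1}s(\theta,Y)$, $$E_\theta\{Z(\theta,Y)^4\}\le B+C\theta^4\quad\text{for all }\theta\in\Theta.$$ Let $(\theta_n)_{n\ge1}\subseteq\Theta$ be a deterministic sequence which converges to $\theta^*$ as $n\to\infty$, and for each $n$ let $\theta_{n\infty}$ be the almost sure limit, as $i\to\infty$, of the predictive resampling sequence $(\theta_{ni})_{i\ge0}$ started at $\theta_{n0}=\theta_n$ (defined in the context). Then $$r_n^{-1}(\theta_{n\infty}-\theta_n)\to\mathcal{N}\{0,\mathcal{I}(\theta^* )^{-1}\}$$ in distribution as $n\to\infty$, where $r_n^2=\sum_{i=n+1}^\infty i^{-2}$.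
   Context: The densities are on a space $\mathcal{Y}$ (with respect to a fixed dominating measure; all functions are understood to be measurable), and $E_\theta$ is expectation under $Y\sim p_\theta$. Predictive resampling (martingale posterior) array: for each $n\ge1$, set $\theta_{n0}=\theta_n$ and for $i\ge1$ draw, conditionally on $\mathcal{F}_{n,i-1}=\sigma(\widetilde Y_{n1},\dots,\widetilde Y_{n,i-1})$ (trivial for $i=1$), $\widetilde Y_{ni}\sim p_{\theta_{n,i-1}}$ and put $$\theta_{ni}=\theta_{n,i-1}+(n+i)^{-1}\,\mathcal{I}(\theta_{n,i-1})^{-1}s(\theta_{n,i-1},\widetilde Y_{ni}).$$ It is understood that all iterates $\theta_{ni}$ lie in $\Theta$ almost surely. Under the hypotheses each row $(\theta_{ni})_{i\ge0}$ is a martingale bounded in $L_2$, so $\theta_{n\infty}=\lim_{i\to\infty}\theta_{ni}$ exists almost surely. *)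

theory Defs
  imports "HOL-Probability.Probability"
begin

text \<open>
  A family of densities is a function \<open>p :: real \<Rightarrow> 'y \<Rightarrow> real\<close>, used only for
  parameters in \<open>\<Theta>\<close>; \<open>M\<close> is the dominating measure.
\<close>

definition model :: "'y measure \<Rightarrow> (real \<Rightarrow> 'y \<Rightarrow> real) \<Rightarrow> real \<Rightarrow> 'y measure" where
  "model M p \<theta> = density M (\<lambda>y. ennreal (p \<theta> y))"

text \<open>
  The derivative of \<open>ln (p \<theta> y)\<close> in \<open>\<theta>\<close> is taken within \<open>\<Theta>\<close>, so it is the ordinary derivative
  at interior points and the one-sided one at end points. Positivity near \<open>\<theta>\<close> is stated because
  \<open>ln 0 = 0\<close> in HOL; a finite derivative of the extended-real logarithm forces it.
\<close>

definition has_score :: "real set \<Rightarrow> (real \<Rightarrow> 'y \<Rightarrow> real) \<Rightarrow> real \<Rightarrow> 'y \<Rightarrow> bool" where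
  "has_score \<Theta> p \<theta> y \<longleftrightarrow>
     \<theta> \<in> \<Theta> \<and> p \<theta> y > 0 \<and> (\<forall>\<^sub>F t in at \<theta> within \<Theta>. p t y > 0) \<and>
     (\<lambda>t. ln (p t y)) differentiable (at \<theta> within \<Theta>)"

text \<open>The value 0 where the score does not exist is a convention.\<close>

definition score :: "real set \<Rightarrow> (real \<Rightarrow> 'y \<Rightarrow> real) \<Rightarrow> real \<Rightarrow> 'y \<Rightarrow> real" where
  "score \<Theta> p \<theta> y =
     (if has_score \<Theta> p \<theta> y then vector_derivative (\<lambda>t. ln (p t y)) (at \<theta> within \<Theta>) else 0)"

definition fisher :: "'y measure \<Rightarrow> real set \<Rightarrow> (real \<Rightarrow> 'y \<Rightarrow> real) \<Rightarrow> real \<Rightarrow> real" where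
  "fisher M \<Theta> p \<theta> = (\<integral>y. (score \<Theta> p \<theta> y)\<^sup>2 \<partial>model M p \<theta>)"

definition scaled_score ::
    "'y measure \<Rightarrow> real set \<Rightarrow> (real \<Rightarrow> 'y \<Rightarrow> real) \<Rightarrow> real \<Rightarrow> 'y \<Rightarrow> real" where
  "scaled_score M \<Theta> p \<theta> y = inverse (fisher M \<Theta> p \<theta>) * score \<Theta> p \<theta> y"

text \<open>
  \<open>iterate M \<Theta> p n t y i\<close> is the \<open>i\<close>-th iterate of row \<open>n\<close> started at \<open>t\<close>, as a function of the
  draws \<open>y 1, y 2, \<dots>\<close>; the value \<open>y 0\<close> is not used.
\<close>

primrec iterate ::
    "'y measure \<Rightarrow> real set \<Rightarrow> (real \<Rightarrow> 'y \<Rightarrow> real) \<Rightarrow> nat \<Rightarrow> real \<Rightarrow> (nat \<Rightarrow> 'y) \<Rightarrow> nat \<Rightarrow> real" where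
  "iterate M \<Theta> p n t y 0 = t"
| "iterate M \<Theta> p n t y (Suc i) =
     iterate M \<Theta> p n t y i +
     inverse (real (n + Suc i)) * scaled_score M \<Theta> p (iterate M \<Theta> p n t y i) (y (Suc i))"

definition limit_iterate ::
    "'y measure \<Rightarrow> real set \<Rightarrow> (real \<Rightarrow> 'y \<Rightarrow> real) \<Rightarrow> nat \<Rightarrow> real \<Rightarrow> (nat \<Rightarrow> 'y) \<Rightarrow> real" where
  "limit_iterate M \<Theta> p n t y = lim (\<lambda>i. iterate M \<Theta> p n t y i)"

text \<open>The \<open>\<sigma>\<close>-algebra generated by \<open>Y 1, \<dots>, Y i\<close>, trivial for \<open>i = 0\<close>.\<close>

definition draws_algebra ::
    "'w measure \<Rightarrow> 'y measure \<Rightarrow> (nat \<Rightarrow> 'w \<Rightarrow> 'y) \<Rightarrow> nat \<Rightarrow> 'w measure" where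
  "draws_algebra W M Y i =
     sigma (space W) (\<Union>j\<in>{1..i}. {Y j -` A \<inter> space W | A. A \<in> sets M})"

text \<open>
  The draws \<open>Y 1, Y 2, \<dots>\<close> on the probability space \<open>W\<close> form a row of the predictive
  resampling array started at \<open>t\<close>.
\<close>

definition predictive_resampling ::
    "'y measure \<Rightarrow> real set \<Rightarrow> (real \<Rightarrow> 'y \<Rightarrow> real) \<Rightarrow> nat \<Rightarrow> real \<Rightarrow>
     'w measure \<Rightarrow> (nat \<Rightarrow> 'w \<Rightarrow> 'y) \<Rightarrow> bool" where
  "predictive_resampling M \<Theta> p n t W Y \<longleftrightarrow>
     prob_space W \<and>
     (\<forall>i\<ge>1. Y i \<in> measurable W M) \<and>
     (AE \<omega> in W. \<forall>i. iterate M \<Theta> p n t (\<lambda>j. Y j \<omega>) i \<in> \<Theta>) \<and>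
     (\<forall>i. \<forall>A\<in>sets M. AE \<omega> in W.
        real_cond_exp W (draws_algebra W M Y i) (\<lambda>\<omega>'. indicator A (Y (Suc i) \<omega>')) \<omega> =
        measure (model M p (iterate M \<Theta> p n t (\<lambda>j. Y j \<omega>) i)) A)"

definition rate :: "nat \<Rightarrow> real" where
  "rate n = sqrt (\<Sum>\<^sub>\<infinity>i\<in>{Suc n..}. inverse ((real i)\<^sup>2))"

text \<open>
  Continuous differentiability near \<open>a\<close> of a function on \<open>S\<close>; neighbourhoods and derivatives are
  relative to \<open>S\<close>.
\<close>

definition C1_near :: "real set \<Rightarrow> (real \<Rightarrow> real) \<Rightarrow> real \<Rightarrow> bool" where
  "C1_near S g a \<longleftrightarrow>
     (\<exists>U D. open U \<and> a \<in> U \<and>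
        (\<forall>x\<in>U \<inter> S. (g has_real_derivative D x) (at x within S)) \<and> continuous_on (U \<inter> S) D)"

end

theory Submission
  imports Defs
begin

text \<open>
  Each row is a martingale with increments \<open>Z\<^sub>i / (n + i)\<close>, where the conditional variance of
  \<open>Z\<^sub>i\<close> is \<open>g(\<theta>) = 1 / I(\<theta>)\<close> at the current iterate. The bound on the fourth moment
  keeps \<open>E \<theta>\<^sub>i^4\<close> bounded uniformly in both indices, so a row moves by \<open>O(n^(-1/2))\<close> in
  \<open>L\<^sup>2\<close> and \<open>g(\<theta>\<^sub>i)\<close> converges in \<open>L\<^sup>1\<close> to \<open>v = g(\<theta>*)\<close> uniformly along the
  row. As \<open>v\<close> and the steps \<open>a\<^sub>j = 1 / ((n + j) r\<^sub>n)\<close> are deterministic, the conditional variances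
  can be compensated by a deterministic factor: \<open>exp(u\<^sup>2 v (a\<^sub>1\<^sup>2 + \<dots> + a\<^sub>i\<^sup>2) / 2)\<close> times the
  characteristic function of the normalised partial sum changes by at most \<open>o(a\<^sub>i\<^sup>2)\<close> in
  each step, and the \<open>a\<^sub>i\<^sup>2\<close> sum to 1.
\<close>

section \<open>Conditional expectations through a kernel\<close>

text \<open>The conditional law of a draw is prescribed one set at a time, each set with its own
  null set, while the proof needs conditional moments of functions of the current iterate and the
  next draw. The passage from sets to such functions is made once; afterwards only an abstract row
  remains, given by adaptedness, conditional mean zero, conditional variance \<open>g\<close> of the
  current iterate and a fourth moment bound. The fourth moment serves twice. It controls the cubic
  Taylor remainder of the characteristic function, and, a variance being non-negative, it dominates
  the square of \<open>g\<close>, which keeps the mean of |g - v| under control even where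
  \<open>g\<close> is unbounded. Compensating by the random product of conditional characteristic
  functions would call for a lower bound on that product, usually by stopping. With a deterministic
  factor the discrepancy between \<open>g\<close> and v enters linearly, weighted by a squared step,
  so convergence in mean is enough. Rows are infinite: the error bounds do not grow with the row
  length, so i tends to infinity first, for fixed n.\<close>

text \<open>
  The witness \<open>J\<close> stands in for the inner integral, which need not be measurable in \<open>\<omega>\<close>
  because the dominating measure is not assumed to be \<open>\<sigma>\<close>-finite.
\<close>

definition kernel_disintegrates ::
    "'w measure \<Rightarrow> 'w measure \<Rightarrow> ('w \<Rightarrow> 'x) \<Rightarrow> ('w \<Rightarrow> 'y) \<Rightarrow> ('x \<Rightarrow> 'y measure) \<Rightarrow>
     ('x \<times> 'y \<Rightarrow> ennreal) \<Rightarrow> bool" where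
  "kernel_disintegrates W F X Y K f \<longleftrightarrow> (\<exists>J\<in>borel_measurable F.
     (AE \<omega> in W. J \<omega> = (\<integral>\<^sup>+y. f (X \<omega>, y) \<partial>K (X \<omega>))) \<and>
     (\<forall>A\<in>sets F. (\<integral>\<^sup>+\<omega>\<in>A. J \<omega> \<partial>W) = (\<integral>\<^sup>+\<omega>\<in>A. f (X \<omega>, Y \<omega>) \<partial>W)))"

context
  fixes W F :: "'w measure" and N :: "'x measure" and M :: "'y measure" and X Y T K
  assumes W: "prob_space W" and sub: "subalgebra W F"
    and X: "X \<in> F \<rightarrow>\<^sub>M N" and Y: "Y \<in> W \<rightarrow>\<^sub>M M"
    and K_sets: "\<And>t. sets (K t) = sets M" and XT: "AE \<omega> in W. X \<omega> \<in> T"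
    and K_prob: "\<And>t. t \<in> T \<Longrightarrow> prob_space (K t)"
    and cond: "\<And>A. A \<in> sets M \<Longrightarrow>
      AE \<omega> in W. real_cond_exp W F (\<lambda>\<omega>'. indicator A (Y \<omega>')) \<omega> = measure (K (X \<omega>)) A"
begin

lemma subalgebra_sets: "A \<in> sets F \<Longrightarrow> A \<in> sets W"
  and subalgebra_space: "space F = space W"
  using sub by (auto simp: subalgebra_def)

lemma measurable_conditioning: "X \<in> W \<rightarrow>\<^sub>M N"
  using X sub measurable_from_subalg by blast

lemma borel_measurable_joint: "f \<in> borel_measurable (N \<Otimes>\<^sub>M M) \<Longrightarrow> (\<lambda>\<omega>. f (X \<omega>, Y \<omega>)) \<in> borel_measurable W"
  for f :: "_ \<Rightarrow> 'b::topological_space"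
  using measurable_conditioning Y by (auto intro: measurable_compose[OF measurable_Pair])

lemma borel_measurable_section:
  fixes f :: "_ \<Rightarrow> 'b::topological_space"
  assumes "f \<in> borel_measurable (N \<Otimes>\<^sub>M M)" "\<omega> \<in> space W"
  shows "(\<lambda>y. f (X \<omega>, y)) \<in> borel_measurable (K (X \<omega>))"
proof -
  have "X \<omega> \<in> space N" using measurable_conditioning assms(2) by (rule measurable_space)
  then have "(\<lambda>y. f (X \<omega>, y)) \<in> borel_measurable M"
    using assms(1) measurable_Pair2 by (auto intro: measurable_Pair2)
  then show ?thesis using measurable_cong_sets[OF K_sets refl] by blast
qed

text \<open>\<open>cond\<close> enters the section here. The factor belonging to \<open>X\<close> is
  \<open>F\<close>-measurable, so it can be absorbed into the test set, and only the defining
  property of the conditional expectation of the \<open>Y\<close> factor is left.\<close>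

lemma disintegrates_rectangle:
  assumes A: "A \<in> sets N" and B: "B \<in> sets M"
  shows "kernel_disintegrates W F X Y K (indicator (A \<times> B))"
proof -
  interpret prob_space W by (rule W)
  interpret finite_measure_subalgebra W F by unfold_locales (rule sub)
  let ?c = "real_cond_exp W F (\<lambda>\<omega>'. indicator B (Y \<omega>'))"
  \<comment> \<open>The conditional expectation itself is the witness, since it is
    \<open>F\<close>-measurable by construction; the kernel value agrees with it only almost
    everywhere.\<close>
  define J where "J \<omega> = ennreal (?c \<omega>) * indicator A (X \<omega>)" for \<omega>
  have intB: "integrable W (\<lambda>\<omega>. indicator B (Y \<omega>) :: real)"
    using Y B by (intro integrable_const_bound[where B=1]) (auto simp: indicator_def)
  have [measurable]: "J \<in> borel_measurable F"
    using A X unfolding J_def by measurable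
  have c: "AE \<omega> in W. ?c \<omega> = measure (K (X \<omega>)) B" by (rule cond[OF B])
  have "AE \<omega> in W. J \<omega> = (\<integral>\<^sup>+y. indicator (A \<times> B) (X \<omega>, y) \<partial>K (X \<omega>))"
    using c XT
  proof eventually_elim
    case (elim \<omega>)
    interpret K: prob_space "K (X \<omega>)" using K_prob elim by auto
    have "(\<integral>\<^sup>+y. indicator (A \<times> B) (X \<omega>, y) \<partial>K (X \<omega>)) =
          (\<integral>\<^sup>+y. indicator A (X \<omega>) * indicator B y \<partial>K (X \<omega>))"
      by (intro nn_integral_cong) (auto simp: indicator_def)
    also have "\<dots> = indicator A (X \<omega>) * emeasure (K (X \<omega>)) B"
      using B K_sets by (subst nn_integral_cmult) (auto intro!: borel_measurable_indicator)
    finally show ?case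
      using elim by (simp add: J_def K.emeasure_eq_measure mult.commute)
  qed
  moreover have "(\<integral>\<^sup>+\<omega>\<in>G. J \<omega> \<partial>W) = (\<integral>\<^sup>+\<omega>\<in>G. indicator (A \<times> B) (X \<omega>, Y \<omega>) \<partial>W)"
    if G: "G \<in> sets F" for G
  proof -
    define H where "H = G \<inter> (X -` A \<inter> space F)"
    have H: "H \<in> sets F" unfolding H_def using X A G by (auto intro!: sets.Int measurable_sets)
    then have HW: "H \<in> sets W" by (rule subalgebra_sets)
    have GW: "G \<subseteq> space W" using G subalgebra_space sets.sets_into_space by blast
    have pos: "AE \<omega> in W. 0 \<le> indicator H \<omega> * ?c \<omega>" using c by eventually_elim auto
    have "(\<integral>\<^sup>+\<omega>\<in>G. J \<omega> \<partial>W) = (\<integral>\<^sup>+\<omega>. ennreal (indicator H \<omega> * ?c \<omega>) \<partial>W)"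
      unfolding J_def H_def using subalgebra_space
      by (intro nn_integral_cong) (auto simp: indicator_def)
    also have "\<dots> = ennreal (\<integral>\<omega>. indicator H \<omega> * ?c \<omega> \<partial>W)"
      using integrable_mult_indicator[OF HW real_cond_exp_int(1)[OF intB]] pos
      by (intro nn_integral_eq_integral) auto
    also have "(\<integral>\<omega>. indicator H \<omega> * ?c \<omega> \<partial>W) = (\<integral>\<omega>. indicator H \<omega> * indicator B (Y \<omega>) \<partial>W)"
      using real_cond_exp_intA[OF intB H] by (simp add: set_lebesgue_integral_def)
    also have "ennreal \<dots> = (\<integral>\<^sup>+\<omega>. ennreal (indicator H \<omega> * indicator B (Y \<omega>)) \<partial>W)"
      using integrable_mult_indicator[OF HW intB]
      by (intro nn_integral_eq_integral[symmetric]) auto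
    also have "\<dots> = (\<integral>\<^sup>+\<omega>\<in>G. indicator (A \<times> B) (X \<omega>, Y \<omega>) \<partial>W)"
      unfolding H_def using GW subalgebra_space
      by (intro nn_integral_cong) (auto simp: indicator_def)
    finally show ?thesis .
  qed
  ultimately show ?thesis unfolding kernel_disintegrates_def by (intro bexI[of _ J]) auto
qed

lemma disintegrates_compl:
  assumes A: "A \<in> sets (N \<Otimes>\<^sub>M M)" and P: "kernel_disintegrates W F X Y K (indicator A)"
  shows "kernel_disintegrates W F X Y K (indicator (space (N \<Otimes>\<^sub>M M) - A))"
proof -
  interpret prob_space W by (rule W)
  let ?S = "space (N \<Otimes>\<^sub>M M)"
  obtain J where J[measurable]: "J \<in> borel_measurable F"
    and J1: "AE \<omega> in W. J \<omega> = (\<integral>\<^sup>+y. indicator A (X \<omega>, y) \<partial>K (X \<omega>))"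
    and J2: "\<And>G. G \<in> sets F \<Longrightarrow> (\<integral>\<^sup>+\<omega>\<in>G. J \<omega> \<partial>W) = (\<integral>\<^sup>+\<omega>\<in>G. indicator A (X \<omega>, Y \<omega>) \<partial>W)"
    using P unfolding kernel_disintegrates_def by blast
  have JW[measurable]: "J \<in> borel_measurable W" using J sub measurable_from_subalg by blast
  have le1: "(\<integral>\<^sup>+y. indicator A (X \<omega>, y) \<partial>K (X \<omega>)) \<le> 1" if "X \<omega> \<in> T" for \<omega>
  proof -
    interpret K: prob_space "K (X \<omega>)" using K_prob that by auto
    have "(\<integral>\<^sup>+y. indicator A (X \<omega>, y) \<partial>K (X \<omega>)) \<le> (\<integral>\<^sup>+y. 1 \<partial>K (X \<omega>))"
      by (intro nn_integral_mono) (auto simp: indicator_def)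
    then show ?thesis by (simp add: K.emeasure_space_1)
  qed
  have "AE \<omega> in W. 1 - J \<omega> = (\<integral>\<^sup>+y. indicator (?S - A) (X \<omega>, y) \<partial>K (X \<omega>))"
    using J1 XT AE_space
  proof eventually_elim
    case (elim \<omega>)
    interpret K: prob_space "K (X \<omega>)" using K_prob elim by auto
    have "(\<integral>\<^sup>+y. indicator (?S - A) (X \<omega>, y) \<partial>K (X \<omega>)) = (\<integral>\<^sup>+y. 1 - indicator A (X \<omega>, y) \<partial>K (X \<omega>))"
      using elim measurable_space[OF measurable_conditioning] sets_eq_imp_space_eq[OF K_sets, of "X \<omega>"]
      by (intro nn_integral_cong) (auto simp: indicator_def space_pair_measure)
    also have "\<dots> = (\<integral>\<^sup>+y. 1 \<partial>K (X \<omega>)) - (\<integral>\<^sup>+y. indicator A (X \<omega>, y) \<partial>K (X \<omega>))"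
    proof (rule nn_integral_diff)
      show "(\<lambda>y. indicator A (X \<omega>, y) :: ennreal) \<in> borel_measurable (K (X \<omega>))"
        using A elim by (intro borel_measurable_section) auto
      show "(\<integral>\<^sup>+y. indicator A (X \<omega>, y) \<partial>K (X \<omega>)) \<noteq> \<infinity>"
        using le1[of \<omega>] elim by (auto simp: top_unique)
    qed (auto simp: indicator_def)
    finally show ?case using elim by (simp add: K.emeasure_space_1)
  qed
  moreover have "(\<integral>\<^sup>+\<omega>\<in>G. (1 - J \<omega>) \<partial>W) = (\<integral>\<^sup>+\<omega>\<in>G. indicator (?S - A) (X \<omega>, Y \<omega>) \<partial>W)"
    if G: "G \<in> sets F" for G
  proof -
    have GW[measurable]: "G \<in> sets W" using G by (rule subalgebra_sets)
    have le: "AE \<omega> in W. J \<omega> \<le> 1" using J1 XT by eventually_elim (use le1 in auto)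
    have m: "(\<lambda>\<omega>. indicator A (X \<omega>, Y \<omega>) :: ennreal) \<in> borel_measurable W"
      using A by (intro borel_measurable_joint) auto
    have fin: "(\<integral>\<^sup>+\<omega>\<in>G. indicator A (X \<omega>, Y \<omega>) \<partial>W) \<noteq> \<infinity>"
    proof -
      have "(\<integral>\<^sup>+\<omega>\<in>G. indicator A (X \<omega>, Y \<omega>) \<partial>W) \<le> (\<integral>\<^sup>+\<omega>. 1 \<partial>W)"
        by (intro nn_integral_mono) (auto simp: indicator_def)
      then show ?thesis by (auto simp: emeasure_space_1 top_unique)
    qed
    have "(\<integral>\<^sup>+\<omega>\<in>G. (1 - J \<omega>) \<partial>W) = (\<integral>\<^sup>+\<omega>. indicator G \<omega> - J \<omega> * indicator G \<omega> \<partial>W)"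
      by (intro nn_integral_cong) (auto simp: indicator_def)
    \<comment> \<open>Subtraction in \<open>ennreal\<close> splits under the integral only if the
      subtrahend has finite integral and is dominated. Finiteness is known for the integral over (X,
      Y) and is carried to \<open>J\<close> by \<open>J2\<close>.\<close>
    also have "\<dots> = (\<integral>\<^sup>+\<omega>. indicator G \<omega> \<partial>W) - (\<integral>\<^sup>+\<omega>\<in>G. J \<omega> \<partial>W)"
      using fin le unfolding J2[OF G, symmetric]
      by (intro nn_integral_diff) (auto simp: indicator_def)
    also have "\<dots> = (\<integral>\<^sup>+\<omega>. indicator G \<omega> \<partial>W) - (\<integral>\<^sup>+\<omega>\<in>G. indicator A (X \<omega>, Y \<omega>) \<partial>W)"
      by (simp only: J2[OF G])
    also have "\<dots> = (\<integral>\<^sup>+\<omega>. indicator G \<omega> - indicator A (X \<omega>, Y \<omega>) * indicator G \<omega> \<partial>W)"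
      using fin m by (intro nn_integral_diff[symmetric]) (auto simp: indicator_def)
    also have "\<dots> = (\<integral>\<^sup>+\<omega>\<in>G. indicator (?S - A) (X \<omega>, Y \<omega>) \<partial>W)"
      using measurable_space[OF measurable_conditioning] measurable_space[OF Y]
      by (intro nn_integral_cong) (auto simp: indicator_def space_pair_measure)
    finally show ?thesis .
  qed
  ultimately show ?thesis unfolding kernel_disintegrates_def by (intro bexI[of _ "\<lambda>\<omega>. 1 - J \<omega>"]) auto
qed

lemma disintegrates_union:
  fixes A :: "nat \<Rightarrow> _"
  assumes d: "disjoint_family A" and A: "\<And>i. A i \<in> sets (N \<Otimes>\<^sub>M M)"
    and P: "\<And>i. kernel_disintegrates W F X Y K (indicator (A i))"
  shows "kernel_disintegrates W F X Y K (indicator (\<Union>i. A i))"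
proof -
  have "\<forall>i. \<exists>J. J \<in> borel_measurable F \<and> (AE \<omega> in W. J \<omega> = (\<integral>\<^sup>+y. indicator (A i) (X \<omega>, y) \<partial>K (X \<omega>))) \<and>
     (\<forall>G\<in>sets F. (\<integral>\<^sup>+\<omega>\<in>G. J \<omega> \<partial>W) = (\<integral>\<^sup>+\<omega>\<in>G. indicator (A i) (X \<omega>, Y \<omega>) \<partial>W))"
    using P unfolding kernel_disintegrates_def by blast
  then obtain J where "\<forall>i. J i \<in> borel_measurable F \<and> (AE \<omega> in W. J i \<omega> = (\<integral>\<^sup>+y. indicator (A i) (X \<omega>, y) \<partial>K (X \<omega>))) \<and>
     (\<forall>G\<in>sets F. (\<integral>\<^sup>+\<omega>\<in>G. J i \<omega> \<partial>W) = (\<integral>\<^sup>+\<omega>\<in>G. indicator (A i) (X \<omega>, Y \<omega>) \<partial>W))"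
    by (rule choice[THEN exE])
  then have J[measurable]: "\<And>i. J i \<in> borel_measurable F"
    and J1: "\<And>i. AE \<omega> in W. J i \<omega> = (\<integral>\<^sup>+y. indicator (A i) (X \<omega>, y) \<partial>K (X \<omega>))"
    and J2: "\<And>i G. G \<in> sets F \<Longrightarrow> (\<integral>\<^sup>+\<omega>\<in>G. J i \<omega> \<partial>W) = (\<integral>\<^sup>+\<omega>\<in>G. indicator (A i) (X \<omega>, Y \<omega>) \<partial>W)"
    by blast+
  have JW[measurable]: "J i \<in> borel_measurable W" for i using J sub measurable_from_subalg by blast
  have ind: "(\<Sum>i. indicator (A i) z) = (indicator (\<Union>i. A i) z :: ennreal)" for z
    by (rule suminf_indicator[OF d])
  have "AE \<omega> in W. \<forall>i. J i \<omega> = (\<integral>\<^sup>+y. indicator (A i) (X \<omega>, y) \<partial>K (X \<omega>))"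
    using J1 by (simp add: AE_all_countable)
  then have "AE \<omega> in W. (\<Sum>i. J i \<omega>) = (\<integral>\<^sup>+y. indicator (\<Union>i. A i) (X \<omega>, y) \<partial>K (X \<omega>))"
    using AE_space
  proof eventually_elim
    case (elim \<omega>)
    have "(\<integral>\<^sup>+y. indicator (\<Union>i. A i) (X \<omega>, y) \<partial>K (X \<omega>)) = (\<integral>\<^sup>+y. (\<Sum>i. indicator (A i) (X \<omega>, y)) \<partial>K (X \<omega>))"
      by (simp only: ind)
    also have "\<dots> = (\<Sum>i. \<integral>\<^sup>+y. indicator (A i) (X \<omega>, y) \<partial>K (X \<omega>))"
      using A elim by (intro nn_integral_suminf borel_measurable_section) auto
    finally show ?case using elim by simp
  qed
  moreover have "(\<integral>\<^sup>+\<omega>\<in>G. (\<Sum>i. J i \<omega>) \<partial>W) = (\<integral>\<^sup>+\<omega>\<in>G. indicator (\<Union>i. A i) (X \<omega>, Y \<omega>) \<partial>W)"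
    if G: "G \<in> sets F" for G
  proof -
    have GW[measurable]: "G \<in> sets W" using G by (rule subalgebra_sets)
    have [measurable]: "(\<lambda>\<omega>. indicator (A i) (X \<omega>, Y \<omega>) :: ennreal) \<in> borel_measurable W" for i
      using A by (intro borel_measurable_joint) auto
    have "(\<integral>\<^sup>+\<omega>\<in>G. (\<Sum>i. J i \<omega>) \<partial>W) = (\<Sum>i. \<integral>\<^sup>+\<omega>\<in>G. J i \<omega> \<partial>W)"
      by (subst nn_integral_suminf[symmetric]) (auto simp: ennreal_suminf_multc)
    also have "\<dots> = (\<Sum>i. \<integral>\<^sup>+\<omega>\<in>G. indicator (A i) (X \<omega>, Y \<omega>) \<partial>W)"
      by (simp only: J2[OF G])
    also have "\<dots> = (\<integral>\<^sup>+\<omega>\<in>G. indicator (\<Union>i. A i) (X \<omega>, Y \<omega>) \<partial>W)"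
      by (subst nn_integral_suminf[symmetric]) (auto simp: ennreal_suminf_multc ind)
    finally show ?thesis .
  qed
  ultimately show ?thesis unfolding kernel_disintegrates_def by (intro bexI[of _ "\<lambda>\<omega>. \<Sum>i. J i \<omega>"]) auto
qed

text \<open>Dynkin's argument: rectangles form an intersection-stable generator of the product, and
  the lemmas on complements and disjoint unions are the closure properties of a Dynkin
  system.\<close>

lemma disintegrates_set:
  assumes "A \<in> sets (N \<Otimes>\<^sub>M M)"
  shows "kernel_disintegrates W F X Y K (indicator A)"
proof -
  let ?G = "{a \<times> b |a b. a \<in> sets N \<and> b \<in> sets M}"
  have sets_eq: "sets (N \<Otimes>\<^sub>M M) = sigma_sets (space N \<times> space M) ?G" by (rule sets_pair_measure)
  show ?thesis
  proof (rule sigma_sets_induct_disjoint[OF Int_stable_pair_measure_generator pair_measure_closed assms[unfolded sets_eq],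
        where P="\<lambda>A. kernel_disintegrates W F X Y K (indicator A)"])
    fix A assume "A \<in> ?G" then show "kernel_disintegrates W F X Y K (indicator A)"
      using disintegrates_rectangle by auto
  next
    show "kernel_disintegrates W F X Y K (indicator {})"
      using disintegrates_rectangle[of "{}" "{}"] by simp
  next
    fix A assume "A \<in> sigma_sets (space N \<times> space M) ?G" "kernel_disintegrates W F X Y K (indicator A)"
    then show "kernel_disintegrates W F X Y K (indicator (space N \<times> space M - A))"
      using disintegrates_compl[of A] unfolding sets_eq space_pair_measure by blast
  next
    fix A :: "nat \<Rightarrow> _" assume "disjoint_family A" "range A \<subseteq> sigma_sets (space N \<times> space M) ?G"
      "\<And>i. kernel_disintegrates W F X Y K (indicator (A i))"
    then show "kernel_disintegrates W F X Y K (indicator (\<Union>i. A i))"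
      by (intro disintegrates_union) (auto simp: sets_eq)
  qed
qed

lemma disintegrates_measurable:
  assumes "f \<in> borel_measurable (N \<Otimes>\<^sub>M M)"
  shows "kernel_disintegrates W F X Y K f"
  using assms
proof (induction rule: borel_measurable_induct)
  case (cong f g)
  have "AE \<omega> in W. (\<integral>\<^sup>+y. f (X \<omega>, y) \<partial>K (X \<omega>)) = (\<integral>\<^sup>+y. g (X \<omega>, y) \<partial>K (X \<omega>))"
    using measurable_space[OF measurable_conditioning] sets_eq_imp_space_eq[OF K_sets] cong(3)
    by (intro AE_I2 nn_integral_cong) (auto simp: space_pair_measure)
  moreover have "(\<integral>\<^sup>+\<omega>\<in>G. f (X \<omega>, Y \<omega>) \<partial>W) = (\<integral>\<^sup>+\<omega>\<in>G. g (X \<omega>, Y \<omega>) \<partial>W)" for G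
    using measurable_space[OF measurable_conditioning] measurable_space[OF Y] cong(3)
    by (intro nn_integral_cong) (auto simp: space_pair_measure)
  ultimately show ?case using cong(4) unfolding kernel_disintegrates_def
    by (elim bexE) (rule bexI, auto elim: AE_mp)
next
  case (set A) then show ?case by (rule disintegrates_set)
next
  case (mult f c)
  then obtain J where J[measurable]: "J \<in> borel_measurable F"
    and J1: "AE \<omega> in W. J \<omega> = (\<integral>\<^sup>+y. f (X \<omega>, y) \<partial>K (X \<omega>))"
    and J2: "\<And>G. G \<in> sets F \<Longrightarrow> (\<integral>\<^sup>+\<omega>\<in>G. J \<omega> \<partial>W) = (\<integral>\<^sup>+\<omega>\<in>G. f (X \<omega>, Y \<omega>) \<partial>W)"
    unfolding kernel_disintegrates_def by blast
  have JW[measurable]: "J \<in> borel_measurable W" using J sub measurable_from_subalg by blast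
  have [measurable]: "(\<lambda>\<omega>. f (X \<omega>, Y \<omega>)) \<in> borel_measurable W" by (rule borel_measurable_joint) fact
  have "AE \<omega> in W. c * J \<omega> = (\<integral>\<^sup>+y. c * f (X \<omega>, y) \<partial>K (X \<omega>))"
    using J1 AE_space by eventually_elim (simp add: nn_integral_cmult[OF borel_measurable_section[OF \<open>f \<in> borel_measurable (N \<Otimes>\<^sub>M M)\<close>]])
  moreover have "(\<integral>\<^sup>+\<omega>\<in>G. (c * J \<omega>) \<partial>W) = (\<integral>\<^sup>+\<omega>\<in>G. (c * f (X \<omega>, Y \<omega>)) \<partial>W)" if G: "G \<in> sets F" for G
    using subalgebra_sets[OF G] J2[OF G] by (simp add: mult.assoc nn_integral_cmult)
  ultimately show ?case unfolding kernel_disintegrates_def by (intro bexI[of _ "\<lambda>\<omega>. c * J \<omega>"]) auto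
next
  case (add f g)
  then obtain J where J[measurable]: "J \<in> borel_measurable F"
    and J1: "AE \<omega> in W. J \<omega> = (\<integral>\<^sup>+y. f (X \<omega>, y) \<partial>K (X \<omega>))"
    and J2: "\<And>G. G \<in> sets F \<Longrightarrow> (\<integral>\<^sup>+\<omega>\<in>G. J \<omega> \<partial>W) = (\<integral>\<^sup>+\<omega>\<in>G. f (X \<omega>, Y \<omega>) \<partial>W)"
    unfolding kernel_disintegrates_def by blast
  from add obtain L where L[measurable]: "L \<in> borel_measurable F"
    and L1: "AE \<omega> in W. L \<omega> = (\<integral>\<^sup>+y. g (X \<omega>, y) \<partial>K (X \<omega>))"
    and L2: "\<And>G. G \<in> sets F \<Longrightarrow> (\<integral>\<^sup>+\<omega>\<in>G. L \<omega> \<partial>W) = (\<integral>\<^sup>+\<omega>\<in>G. g (X \<omega>, Y \<omega>) \<partial>W)"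
    unfolding kernel_disintegrates_def by blast
  have JW[measurable]: "J \<in> borel_measurable W" "L \<in> borel_measurable W"
    using J L sub measurable_from_subalg by blast+
  have [measurable]: "(\<lambda>\<omega>. f (X \<omega>, Y \<omega>)) \<in> borel_measurable W" "(\<lambda>\<omega>. g (X \<omega>, Y \<omega>)) \<in> borel_measurable W"
    by (rule borel_measurable_joint, fact)+
  have "AE \<omega> in W. L \<omega> + J \<omega> = (\<integral>\<^sup>+y. g (X \<omega>, y) + f (X \<omega>, y) \<partial>K (X \<omega>))"
    using J1 L1 AE_space by eventually_elim
      (simp add: nn_integral_add[OF borel_measurable_section[OF \<open>g \<in> borel_measurable (N \<Otimes>\<^sub>M M)\<close>]
        borel_measurable_section[OF \<open>f \<in> borel_measurable (N \<Otimes>\<^sub>M M)\<close>]])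
  moreover have "(\<integral>\<^sup>+\<omega>\<in>G. (L \<omega> + J \<omega>) \<partial>W) = (\<integral>\<^sup>+\<omega>\<in>G. (g (X \<omega>, Y \<omega>) + f (X \<omega>, Y \<omega>)) \<partial>W)"
    if G: "G \<in> sets F" for G
    using subalgebra_sets[OF G] J2[OF G] L2[OF G] by (simp add: distrib_right nn_integral_add)
  ultimately show ?case unfolding kernel_disintegrates_def by (intro bexI[of _ "\<lambda>\<omega>. L \<omega> + J \<omega>"]) auto
next
  case (seq U)
  have "\<forall>i. \<exists>J. J \<in> borel_measurable F \<and> (AE \<omega> in W. J \<omega> = (\<integral>\<^sup>+y. U i (X \<omega>, y) \<partial>K (X \<omega>))) \<and>
     (\<forall>G\<in>sets F. (\<integral>\<^sup>+\<omega>\<in>G. J \<omega> \<partial>W) = (\<integral>\<^sup>+\<omega>\<in>G. U i (X \<omega>, Y \<omega>) \<partial>W))"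
    using seq unfolding kernel_disintegrates_def by blast
  then obtain J where "\<forall>i. J i \<in> borel_measurable F \<and> (AE \<omega> in W. J i \<omega> = (\<integral>\<^sup>+y. U i (X \<omega>, y) \<partial>K (X \<omega>))) \<and>
     (\<forall>G\<in>sets F. (\<integral>\<^sup>+\<omega>\<in>G. J i \<omega> \<partial>W) = (\<integral>\<^sup>+\<omega>\<in>G. U i (X \<omega>, Y \<omega>) \<partial>W))"
    by (rule choice[THEN exE])
  then have J[measurable]: "\<And>i. J i \<in> borel_measurable F"
    and J1: "\<And>i. AE \<omega> in W. J i \<omega> = (\<integral>\<^sup>+y. U i (X \<omega>, y) \<partial>K (X \<omega>))"
    and J2: "\<And>i G. G \<in> sets F \<Longrightarrow> (\<integral>\<^sup>+\<omega>\<in>G. J i \<omega> \<partial>W) = (\<integral>\<^sup>+\<omega>\<in>G. U i (X \<omega>, Y \<omega>) \<partial>W)"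
    by blast+
  have JW[measurable]: "J i \<in> borel_measurable W" for i using J sub measurable_from_subalg by blast
  have [measurable]: "(\<lambda>\<omega>. U i (X \<omega>, Y \<omega>)) \<in> borel_measurable W" for i
    by (rule borel_measurable_joint) (rule seq)
  have J1': "AE \<omega> in W. \<forall>i. J i \<omega> = (\<integral>\<^sup>+y. U i (X \<omega>, y) \<partial>K (X \<omega>))"
    using J1 by (simp add: AE_all_countable)
  then have "AE \<omega> in W. (SUP i. J i \<omega>) = (\<integral>\<^sup>+y. (SUP i. U i) (X \<omega>, y) \<partial>K (X \<omega>))"
    using AE_space
  proof eventually_elim
    case (elim \<omega>)
    have "(\<integral>\<^sup>+y. (SUP i. U i (X \<omega>, y)) \<partial>K (X \<omega>)) = (SUP i. \<integral>\<^sup>+y. U i (X \<omega>, y) \<partial>K (X \<omega>))"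
      using \<open>incseq U\<close> elim borel_measurable_section[OF seq(1)]
      by (intro nn_integral_monotone_convergence_SUP) (auto simp: incseq_def le_fun_def)
    then show ?case using elim by (simp add: image_comp)
  qed
  moreover have "(\<integral>\<^sup>+\<omega>\<in>G. (SUP i. J i \<omega>) \<partial>W) = (\<integral>\<^sup>+\<omega>\<in>G. (SUP i. U i) (X \<omega>, Y \<omega>) \<partial>W)"
    if G: "G \<in> sets F" for G
  proof -
    have GW[measurable]: "G \<in> sets W" using G by (rule subalgebra_sets)
    \<comment> \<open>The witnesses were chosen separately for each \<open>i\<close>, so they
      increase only where they equal the inner integrals; hence the almost-everywhere form of
      monotone convergence for \<open>J\<close> and the plain form for \<open>U\<close>.\<close>
    have mono: "AE \<omega> in W. \<forall>i. J i \<omega> * indicator G \<omega> \<le> J (Suc i) \<omega> * indicator G \<omega>"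
      using J1' by eventually_elim
        (use \<open>incseq U\<close> in \<open>auto simp: incseq_Suc_iff le_fun_def intro!: mult_right_mono nn_integral_mono\<close>)
    have "(\<integral>\<^sup>+\<omega>\<in>G. (SUP i. J i \<omega>) \<partial>W) = (\<integral>\<^sup>+\<omega>. (SUP i. J i \<omega> * indicator G \<omega>) \<partial>W)"
      by (simp add: SUP_mult_right_ennreal)
    also have "\<dots> = (SUP i. \<integral>\<^sup>+\<omega>\<in>G. J i \<omega> \<partial>W)"
      using mono by (intro nn_integral_monotone_convergence_SUP_AE) (auto simp: AE_all_countable)
    also have "\<dots> = (SUP i. \<integral>\<^sup>+\<omega>\<in>G. U i (X \<omega>, Y \<omega>) \<partial>W)"
      by (simp only: J2[OF G])
    also have "\<dots> = (\<integral>\<^sup>+\<omega>. (SUP i. U i (X \<omega>, Y \<omega>) * indicator G \<omega>) \<partial>W)"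
      using \<open>incseq U\<close>
      by (intro nn_integral_monotone_convergence_SUP[symmetric])
         (auto simp: incseq_def le_fun_def intro!: mult_right_mono)
    also have "\<dots> = (\<integral>\<^sup>+\<omega>\<in>G. (SUP i. U i) (X \<omega>, Y \<omega>) \<partial>W)"
      by (simp add: SUP_mult_right_ennreal image_comp)
    finally show ?thesis .
  qed
  ultimately show ?case unfolding kernel_disintegrates_def
    by (intro bexI[of _ "\<lambda>\<omega>. SUP i. J i \<omega>"]) auto
qed

text \<open>The witness is \<open>F\<close>-measurable and has the right integral over every set of
  \<open>F\<close>, so uniqueness makes it a version of the conditional expectation.\<close>

lemma nn_cond_exp_kernel:
  assumes f: "f \<in> borel_measurable (N \<Otimes>\<^sub>M M)"
  shows "AE \<omega> in W. nn_cond_exp W F (\<lambda>\<omega>. f (X \<omega>, Y \<omega>)) \<omega> = (\<integral>\<^sup>+y. f (X \<omega>, y) \<partial>K (X \<omega>))"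
proof -
  interpret prob_space W by (rule W)
  interpret finite_measure_subalgebra W F by unfold_locales (rule sub)
  obtain J where J: "J \<in> borel_measurable F"
    and J1: "AE \<omega> in W. J \<omega> = (\<integral>\<^sup>+y. f (X \<omega>, y) \<partial>K (X \<omega>))"
    and J2: "\<And>G. G \<in> sets F \<Longrightarrow> (\<integral>\<^sup>+\<omega>\<in>G. J \<omega> \<partial>W) = (\<integral>\<^sup>+\<omega>\<in>G. f (X \<omega>, Y \<omega>) \<partial>W)"
    using disintegrates_measurable[OF f] unfolding kernel_disintegrates_def by blast
  have "AE \<omega> in W. J \<omega> = nn_cond_exp W F (\<lambda>\<omega>. f (X \<omega>, Y \<omega>)) \<omega>"
    by (rule nn_cond_exp_charact[OF J2[symmetric] borel_measurable_joint[OF f] J])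
  then show ?thesis using J1 by eventually_elim simp
qed

text \<open>Difference of the non-negative statements for f and -f. Integrability is asked of each
  section under \<open>K t\<close>, not of f(X, Y) under \<open>W\<close>, which for the rows
  becomes available only after the moment bounds.\<close>

lemma real_cond_exp_kernel:
  fixes f :: "_ \<Rightarrow> real"
  assumes f: "f \<in> borel_measurable (N \<Otimes>\<^sub>M M)"
    and int: "\<And>t. t \<in> T \<Longrightarrow> integrable (K t) (\<lambda>y. f (t, y))"
  shows "AE \<omega> in W. real_cond_exp W F (\<lambda>\<omega>. f (X \<omega>, Y \<omega>)) \<omega> = (\<integral>y. f (X \<omega>, y) \<partial>K (X \<omega>))"
proof -
  have "AE \<omega> in W. nn_cond_exp W F (\<lambda>\<omega>. ennreal (f (X \<omega>, Y \<omega>))) \<omega> = (\<integral>\<^sup>+y. ennreal (f (X \<omega>, y)) \<partial>K (X \<omega>))"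
    using f by (intro nn_cond_exp_kernel[of "\<lambda>z. ennreal (f z)"]) auto
  moreover have "AE \<omega> in W. nn_cond_exp W F (\<lambda>\<omega>. ennreal (- f (X \<omega>, Y \<omega>))) \<omega> = (\<integral>\<^sup>+y. ennreal (- f (X \<omega>, y)) \<partial>K (X \<omega>))"
    using f by (intro nn_cond_exp_kernel[of "\<lambda>z. ennreal (- f z)"]) auto
  ultimately show ?thesis using XT
    by eventually_elim (simp add: real_cond_exp_def real_lebesgue_integral_def[OF int])
qed

end

section \<open>Moment bounds\<close>

lemma power4_nonneg: "0 \<le> (t::real) ^ 4" by simp

lemma power4_add_le: "(s + t) ^ 4 \<le> 8 * (s ^ 4 + (t::real) ^ 4)"
proof -
  have sq: "(p + q)\<^sup>2 \<le> 2 * (p\<^sup>2 + q\<^sup>2)" for p q :: real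
    using sum_squares_bound[of p q] by (simp add: power2_sum)
  have "((s + t)\<^sup>2)\<^sup>2 \<le> (2 * (s\<^sup>2 + t\<^sup>2))\<^sup>2" using sq by (intro power_mono) auto
  also have "\<dots> = 4 * (s\<^sup>2 + t\<^sup>2)\<^sup>2" by (simp only: power_mult_distrib) simp
  also have "\<dots> \<le> 4 * (2 * ((s\<^sup>2)\<^sup>2 + (t\<^sup>2)\<^sup>2))" by (intro mult_left_mono sq) simp
  finally show ?thesis by simp
qed

lemma power_le_one_plus_power4:
  fixes t :: real
  shows "\<bar>t\<bar> \<le> 1 + t ^ 4" "t\<^sup>2 \<le> 1 + t ^ 4" "\<bar>t\<bar> ^ 3 \<le> 1 + t ^ 4"
proof -
  have p: "\<bar>t\<bar> ^ k \<le> 1 + \<bar>t\<bar> ^ 4" if "k \<le> 4" for k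
  proof (cases "\<bar>t\<bar> \<le> 1")
    case True
    then have "\<bar>t\<bar> ^ k \<le> 1" by (intro power_le_one) auto
    then show ?thesis by (simp add: add_increasing2)
  next
    case False
    then have "\<bar>t\<bar> ^ k \<le> \<bar>t\<bar> ^ 4" using that by (intro power_increasing) auto
    then show ?thesis by simp
  qed
  show "\<bar>t\<bar> \<le> 1 + t ^ 4" "t\<^sup>2 \<le> 1 + t ^ 4" "\<bar>t\<bar> ^ 3 \<le> 1 + t ^ 4"
    using p[of 1] p[of 2] p[of 3] by auto
qed

lemma power4_young:
  fixes s t :: real
  shows "\<bar>s ^ 3 * t\<bar> \<le> s ^ 4 + t ^ 4" "\<bar>s * t\<bar> \<le> 1 + s ^ 4 + t ^ 4"
proof -
  have "\<bar>s\<bar> ^ 3 * \<bar>t\<bar> \<le> (max \<bar>s\<bar> \<bar>t\<bar>) ^ 3 * max \<bar>s\<bar> \<bar>t\<bar>" by (intro mult_mono power_mono) auto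
  also have "\<dots> = (max \<bar>s\<bar> \<bar>t\<bar>) ^ 4" by (simp add: power_eq_if)
  also have "\<dots> \<le> \<bar>s\<bar> ^ 4 + \<bar>t\<bar> ^ 4" by (auto simp: max_def)
  finally show "\<bar>s ^ 3 * t\<bar> \<le> s ^ 4 + t ^ 4" by (simp add: abs_mult power_abs)
  have "2 * (\<bar>s\<bar> * \<bar>t\<bar>) \<le> s\<^sup>2 + t\<^sup>2" "0 \<le> \<bar>s\<bar> * \<bar>t\<bar>"
    using sum_squares_bound[of "\<bar>s\<bar>" "\<bar>t\<bar>"] by (simp_all add: mult.assoc)
  then have "\<bar>s * t\<bar> \<le> s\<^sup>2 + t\<^sup>2" unfolding abs_mult by linarith
  moreover have "s\<^sup>2 \<le> 1/2 + s ^ 4 / 2" "t\<^sup>2 \<le> 1/2 + t ^ 4 / 2"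
    using sum_squares_bound[of 1 "s\<^sup>2"] sum_squares_bound[of 1 "t\<^sup>2"] by auto
  moreover have "0 \<le> s ^ 4" "0 \<le> t ^ 4" by auto
  ultimately show "\<bar>s * t\<bar> \<le> 1 + s ^ 4 + t ^ 4" by linarith
qed

text \<open>The term linear in t is kept exact because its expectation will vanish. In the binomial
  expansion, 4 s (d t)^3 is at most 2 d^2 s^2 t^2 + 2 d^4 t^4, leaving 8 d^2 s^2 t^2 + 3 d^4 t^4;
  then 2 s^2 t^2 <= s^4 + t^4 and d^4 <= d^2 give 4 and 4 + 3 = 7.\<close>

lemma power4_step:
  fixes s t d :: real
  assumes d: "0 \<le> d" "d \<le> 1"
  shows "(s + d * t) ^ 4 \<le> s ^ 4 + 4 * d * (s ^ 3 * t) + d\<^sup>2 * (4 * s ^ 4 + 7 * t ^ 4)"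
proof -
  have d4: "d ^ 4 \<le> d\<^sup>2" using d by (intro power_decreasing) auto
  have "2 * (s * (d * t)) \<le> s\<^sup>2 + (d * t)\<^sup>2" using sum_squares_bound[of s "d * t"] by simp
  then have "2 * (d * t)\<^sup>2 * (2 * (s * (d * t))) \<le> 2 * (d * t)\<^sup>2 * (s\<^sup>2 + (d * t)\<^sup>2)" by (intro mult_left_mono) auto
  then have 1: "4 * s * (d * t) ^ 3 \<le> 2 * d\<^sup>2 * (s\<^sup>2 * t\<^sup>2) + 2 * d ^ 4 * t ^ 4"
    by (simp add: power2_eq_square power3_eq_cube power4_eq_xxxx algebra_simps)
  have "2 * (s\<^sup>2 * t\<^sup>2) \<le> s ^ 4 + t ^ 4" using sum_squares_bound[of "s\<^sup>2" "t\<^sup>2"] by simp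
  then have 2: "8 * d\<^sup>2 * (s\<^sup>2 * t\<^sup>2) \<le> 4 * d\<^sup>2 * (s ^ 4 + t ^ 4)"
    using mult_left_mono[of "2 * (s\<^sup>2 * t\<^sup>2)" "s ^ 4 + t ^ 4" "4 * d\<^sup>2"] by simp
  have 3: "3 * (d ^ 4 * t ^ 4) \<le> 3 * (d\<^sup>2 * t ^ 4)" using mult_right_mono[OF d4, of "t ^ 4"] by simp
  have "(s + d * t) ^ 4 = s ^ 4 + 4 * d * (s ^ 3 * t) + 6 * d\<^sup>2 * (s\<^sup>2 * t\<^sup>2) + 4 * s * (d * t) ^ 3 + d ^ 4 * t ^ 4"
    by (simp add: power2_eq_square power3_eq_cube power4_eq_xxxx algebra_simps)
  also have "\<dots> \<le> s ^ 4 + 4 * d * (s ^ 3 * t) + d\<^sup>2 * (4 * s ^ 4 + 7 * t ^ 4)"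
    using 1 2 3 by (simp add: algebra_simps)
  finally show ?thesis .
qed

text \<open>Dominates the fourth moment of every \<open>z i\<close> in a row started at
  \<open>c\<close>: the envelope B + C E(x^4), with E(x^4) replaced by the Gronwall bound of
  \<open>x4_le\<close>. It is free of both \<open>n\<close> and \<open>i\<close>; the exponent
  collects the constants 4 and 7 of \<open>power4_step\<close>.\<close>

definition moment_bound :: "real \<Rightarrow> real \<Rightarrow> real \<Rightarrow> real" where
  "moment_bound B C c = B + C * ((c ^ 4 + 1) * exp (4 + 7 * B + 7 * C))"

text \<open>One row, stripped of the model. The index is shifted: \<open>z i\<close> is the
  increment leading from \<open>x i\<close> to \<open>x (Suc i)\<close> and is conditioned on
  \<open>F i\<close>. The assumption \<open>fourth\<close> uses the non-negative conditional
  expectation because integrability of the fourth power is still to be derived; \<open>T\<close> is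
  where the growth bound on \<open>g\<close> holds.\<close>

locale adapted_recursion = prob_space W for W :: "'w measure" +
  fixes F :: "nat \<Rightarrow> 'w measure" and x z :: "nat \<Rightarrow> 'w \<Rightarrow> real"
    and g :: "real \<Rightarrow> real" and T :: "real set" and B C c :: real and n :: nat
  assumes subalg: "subalgebra W (F i)"
    and x_F: "k \<le> i \<Longrightarrow> x k \<in> borel_measurable (F i)"
    and z_W [measurable]: "z i \<in> borel_measurable W"
    and x_0: "x 0 \<omega> = c"
    and x_step: "x (Suc i) \<omega> = x i \<omega> + inverse (real (n + Suc i)) * z i \<omega>"
    and x_T: "AE \<omega> in W. x i \<omega> \<in> T"
    and g_meas [measurable]: "g \<in> borel_measurable borel"
    and mean: "AE \<omega> in W. real_cond_exp W (F i) (z i) \<omega> = 0"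
    and var: "AE \<omega> in W. real_cond_exp W (F i) (\<lambda>\<omega>. (z i \<omega>)\<^sup>2) \<omega> = g (x i \<omega>)"
    and fourth: "AE \<omega> in W. nn_cond_exp W (F i) (\<lambda>\<omega>. ennreal ((z i \<omega>) ^ 4)) \<omega> \<le> ennreal (B + C * x i \<omega> ^ 4)"
    and g_le: "t \<in> T \<Longrightarrow> (g t)\<^sup>2 \<le> B + C * t ^ 4"
    and B: "0 \<le> B" and C: "0 \<le> C" and n: "1 \<le> n"
begin

section \<open>Moments and increments of one row\<close>

definition b :: "nat \<Rightarrow> real" where "b i = inverse (real (n + Suc i))"
abbreviation Q :: real where "Q \<equiv> moment_bound B C c"

lemma sigma_finite_subalgebra_F: "sigma_finite_subalgebra W (F i)"
proof -
  interpret finite_measure_subalgebra W "F i" by unfold_locales (rule subalg)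
  show ?thesis by unfold_locales
qed

lemma x_W [measurable]: "x i \<in> borel_measurable W"
  using x_F[of i i] subalg measurable_from_subalg by blast

lemma x_Suc: "x (Suc i) \<omega> = x i \<omega> + b i * z i \<omega>"
  by (simp add: b_def x_step)

lemma b_pos: "0 < b i" and b_le_1: "b i \<le> 1"
  using n by (auto simp: b_def inverse_le_1_iff)

text \<open>Makes sums of squared steps telescope; this is the source of every bound of order 1/n
  along a row.\<close>

lemma b_sq: "(b i)\<^sup>2 \<le> 1 / real (n + i) - 1 / real (n + Suc i)"
proof -
  define m where "m = real (n + i)"
  have m: "m \<ge> 1" using n by (simp add: m_def)
  have "(b i)\<^sup>2 = 1 / ((m + 1) * (m + 1))" by (simp add: b_def m_def power2_eq_square field_simps)
  also have "\<dots> \<le> 1 / (m * (m + 1))" using m by (intro divide_left_mono mult_right_mono) auto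
  also have "\<dots> = 1 / m - 1 / (m + 1)" using m by (simp add: field_simps)
  finally show ?thesis by (simp add: m_def add_ac)
qed

text \<open>The tower property holds in [0, \<infinity>] without integrability, so finiteness of the
  moment of \<open>z i\<close> comes out as a conclusion from that of \<open>x i\<close>.\<close>

lemma fourth_moment_step:
  assumes x4: "integrable W (\<lambda>\<omega>. x i \<omega> ^ 4)"
  shows "integrable W (\<lambda>\<omega>. z i \<omega> ^ 4)"
    and "(\<integral>\<omega>. z i \<omega> ^ 4 \<partial>W) \<le> B + C * (\<integral>\<omega>. x i \<omega> ^ 4 \<partial>W)"
proof -
  interpret sigma_finite_subalgebra W "F i" by (rule sigma_finite_subalgebra_F)
  have nonneg: "0 \<le> \<integral>\<omega>. x i \<omega> ^ 4 \<partial>W" by simp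
  have "(\<integral>\<^sup>+\<omega>. ennreal (z i \<omega> ^ 4) \<partial>W) = (\<integral>\<^sup>+\<omega>. nn_cond_exp W (F i) (\<lambda>\<omega>. ennreal ((z i \<omega>) ^ 4)) \<omega> \<partial>W)"
    using nn_cond_exp_intg[of "\<lambda>_. 1" "\<lambda>\<omega>. ennreal ((z i \<omega>) ^ 4)"] by simp
  also have "\<dots> \<le> (\<integral>\<^sup>+\<omega>. ennreal (B + C * x i \<omega> ^ 4) \<partial>W)"
    using fourth by (rule nn_integral_mono_AE)
  also have "\<dots> = ennreal (\<integral>\<omega>. B + C * x i \<omega> ^ 4 \<partial>W)"
    using x4 B C by (intro nn_integral_eq_integral) auto
  also have "(\<integral>\<omega>. B + C * x i \<omega> ^ 4 \<partial>W) = B + C * (\<integral>\<omega>. x i \<omega> ^ 4 \<partial>W)"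
    using x4 by (simp add: prob_space)
  finally have le: "(\<integral>\<^sup>+\<omega>. ennreal (z i \<omega> ^ 4) \<partial>W) \<le> ennreal (B + C * (\<integral>\<omega>. x i \<omega> ^ 4 \<partial>W))" .
  show *: "integrable W (\<lambda>\<omega>. z i \<omega> ^ 4)"
    using le by (intro integrableI_nonneg) (auto simp: less_top[symmetric] top_unique)
  show "(\<integral>\<omega>. z i \<omega> ^ 4 \<partial>W) \<le> B + C * (\<integral>\<omega>. x i \<omega> ^ 4 \<partial>W)"
    using le mult_nonneg_nonneg[OF C nonneg] B by (subst (asm) nn_integral_eq_integral[OF *]) (auto simp del: ennreal_plus)
qed

lemma integrable_x4: "integrable W (\<lambda>\<omega>. x i \<omega> ^ 4)"
proof (induction i)
  case 0 then show ?case by (simp add: x_0)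
next
  case (Suc i)
  show ?case
  proof (rule Bochner_Integration.integrable_bound)
    show "integrable W (\<lambda>\<omega>. 8 * (x i \<omega> ^ 4 + z i \<omega> ^ 4))"
      using Suc fourth_moment_step(1)[OF Suc] by auto
    have "x (Suc i) \<omega> ^ 4 \<le> 8 * (x i \<omega> ^ 4 + z i \<omega> ^ 4)" for \<omega>
    proof -
      have "(b i * z i \<omega>) ^ 4 \<le> 1 * z i \<omega> ^ 4"
        using b_pos[of i] b_le_1[of i] unfolding power_mult_distrib
        by (intro mult_right_mono power_le_one) auto
      then show ?thesis using power4_add_le[of "x i \<omega>" "b i * z i \<omega>"] by (simp add: x_Suc)
    qed
    then show "AE \<omega> in W. norm (x (Suc i) \<omega> ^ 4) \<le> norm (8 * (x i \<omega> ^ 4 + z i \<omega> ^ 4))"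
      by (auto intro!: AE_I2 simp: abs_mult)
  qed simp
qed

lemma integrable_z4: "integrable W (\<lambda>\<omega>. z i \<omega> ^ 4)"
  using fourth_moment_step(1) integrable_x4 by blast

text \<open>A common envelope for the integrands below; the extra index \<open>j\<close> admits
  products involving an iterate from another time.\<close>

lemma integrable_dominated:
  fixes f :: "'w \<Rightarrow> 'b::{banach, second_countable_topology}"
  assumes "f \<in> borel_measurable W" "\<And>\<omega>. norm (f \<omega>) \<le> k * (1 + x j \<omega> ^ 4 + x i \<omega> ^ 4 + z i \<omega> ^ 4)"
  shows "integrable W f"
proof (rule Bochner_Integration.integrable_bound)
  show "integrable W (\<lambda>\<omega>. k * (1 + x j \<omega> ^ 4 + x i \<omega> ^ 4 + z i \<omega> ^ 4))"
    using integrable_x4 integrable_z4 by auto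
qed (use assms order_trans[OF assms(2) abs_ge_self] in auto)

text \<open>Orthogonality of a martingale difference to the past: the \<open>F i\<close>-measurable
  factor is pulled out of the conditional expectation.\<close>

lemma integral_mult_z:
  assumes "h \<in> borel_measurable (F i)" "integrable W (\<lambda>\<omega>. h \<omega> * z i \<omega>)"
  shows "(\<integral>\<omega>. h \<omega> * z i \<omega> \<partial>W) = 0"
proof -
  interpret sigma_finite_subalgebra W "F i" by (rule sigma_finite_subalgebra_F)
  have "(\<integral>\<omega>. h \<omega> * z i \<omega> \<partial>W) = (\<integral>\<omega>. h \<omega> * real_cond_exp W (F i) (z i) \<omega> \<partial>W)"
    using real_cond_exp_intg(2)[OF assms(2,1)] by simp
  also have "\<dots> = 0" using mean[of i] by (intro integral_eq_zero_AE) auto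
  finally show ?thesis .
qed

lemma integral_mult_z2:
  assumes h[measurable]: "h \<in> borel_measurable (F i)" and "integrable W (\<lambda>\<omega>. h \<omega> * (z i \<omega>)\<^sup>2)"
  shows "(\<integral>\<omega>. h \<omega> * (z i \<omega>)\<^sup>2 \<partial>W) = (\<integral>\<omega>. h \<omega> * g (x i \<omega>) \<partial>W)"
proof -
  interpret sigma_finite_subalgebra W "F i" by (rule sigma_finite_subalgebra_F)
  have [measurable]: "h \<in> borel_measurable W" using h subalg measurable_from_subalg by blast
  have "(\<integral>\<omega>. h \<omega> * (z i \<omega>)\<^sup>2 \<partial>W) = (\<integral>\<omega>. h \<omega> * real_cond_exp W (F i) (\<lambda>\<omega>. (z i \<omega>)\<^sup>2) \<omega> \<partial>W)"
    using real_cond_exp_intg(2)[OF assms(2,1)] by simp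
  also have "\<dots> = (\<integral>\<omega>. h \<omega> * g (x i \<omega>) \<partial>W)"
    using var[of i] by (intro integral_cong_AE) auto
  finally show ?thesis .
qed

text \<open>Discrete Gronwall inequality: each step multiplies E(x^4) + 1 by at most exp(D b^2), and
  the squared steps sum to at most 1/n <= 1.\<close>

lemma x4_le: "(\<integral>\<omega>. x i \<omega> ^ 4 \<partial>W) \<le> (c ^ 4 + 1) * exp (4 + 7 * B + 7 * C)"
proof -
  define D where "D = 4 + 7 * B + 7 * C"
  define m where "m i = (\<integral>\<omega>. x i \<omega> ^ 4 \<partial>W)" for i
  have m0: "0 \<le> m i" for i unfolding m_def by simp
  have D0: "0 \<le> D" using B C by (simp add: D_def)
  \<comment> \<open>Adding 1 absorbs the constant \<open>B\<close>, so that the affine recursion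
    becomes multiplicative: 4 m + 7 (B + C m) <= D (m + 1).\<close>
  have step: "m (Suc i) + 1 \<le> (m i + 1) * exp (D * (b i)\<^sup>2)" for i
  proof -
    have i1: "integrable W (\<lambda>\<omega>. x i \<omega> ^ 3 * z i \<omega>)"
    proof (rule integrable_dominated[where k=1 and i=i and j=i])
      fix \<omega> show "norm (x i \<omega> ^ 3 * z i \<omega>) \<le> 1 * (1 + x i \<omega> ^ 4 + x i \<omega> ^ 4 + z i \<omega> ^ 4)"
        unfolding real_norm_def mult_1_left using power4_young(1)[of "x i \<omega>" "z i \<omega>"] power4_nonneg[of "x i \<omega>"] by linarith
    qed measurable
    have "x i \<in> borel_measurable (F i)" using x_F by simp
    then have z: "(\<integral>\<omega>. x i \<omega> ^ 3 * z i \<omega> \<partial>W) = 0"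
      using i1 by (intro integral_mult_z) auto
    have "m (Suc i) \<le> (\<integral>\<omega>. x i \<omega> ^ 4 + 4 * b i * (x i \<omega> ^ 3 * z i \<omega>) + (b i)\<^sup>2 * (4 * x i \<omega> ^ 4 + 7 * z i \<omega> ^ 4) \<partial>W)"
      unfolding m_def x_Suc using i1 integrable_x4 integrable_z4 b_pos b_le_1
      by (intro integral_mono power4_step) (auto simp: less_imp_le simp flip: x_Suc)
    also have "\<dots> = m i + (b i)\<^sup>2 * (4 * m i + 7 * (\<integral>\<omega>. z i \<omega> ^ 4 \<partial>W))"
      using i1 integrable_x4 integrable_z4 z by (simp add: m_def)
    also have "\<dots> \<le> m i + (b i)\<^sup>2 * (4 * m i + 7 * (B + C * m i))"
      using fourth_moment_step(2)[OF integrable_x4] by (intro add_left_mono mult_left_mono) (auto simp: m_def)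
    also have "\<dots> \<le> m i + (b i)\<^sup>2 * (D * (m i + 1))"
      using m0[of i] B C by (intro add_left_mono mult_left_mono) (auto simp: D_def algebra_simps)
    finally have "m (Suc i) + 1 \<le> (m i + 1) * (1 + D * (b i)\<^sup>2)" by (simp add: algebra_simps)
    also have "\<dots> \<le> (m i + 1) * exp (D * (b i)\<^sup>2)"
      using m0[of i] by (intro mult_left_mono) (auto simp: exp_ge_add_one_self)
    finally show ?thesis .
  qed
  \<comment> \<open>The exponent is carried in telescoped form, which lets the induction close
    exactly; it is replaced by \<open>D\<close> only at the end.\<close>
  have "m i + 1 \<le> (c ^ 4 + 1) * exp (D * (1 / real n - 1 / real (n + i)))" for i
  proof (induction i)
    case 0 then show ?case by (simp add: m_def x_0 prob_space)
  next
    case (Suc i)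
    have "m (Suc i) + 1 \<le> (m i + 1) * exp (D * (b i)\<^sup>2)" by (rule step)
    also have "\<dots> \<le> ((c ^ 4 + 1) * exp (D * (1 / real n - 1 / real (n + i)))) * exp (D * (1 / real (n + i) - 1 / real (n + Suc i)))"
      using Suc b_sq[of i] D0 m0[of i] by (intro mult_mono) (auto intro!: mult_left_mono)
    also have "\<dots> = (c ^ 4 + 1) * exp (D * (1 / real n - 1 / real (n + Suc i)))"
      by (simp add: mult.assoc flip: exp_add) (simp add: algebra_simps)
    finally show ?case .
  qed
  from this[of i] have "m i + 1 \<le> (c ^ 4 + 1) * exp (D * (1 / real n - 1 / real (n + i)))" .
  also have "\<dots> \<le> (c ^ 4 + 1) * exp D"
  proof -
    have "1 / real n \<le> 1" "0 \<le> 1 / real (n + i)" using n by auto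
    then have "1 / real n - 1 / real (n + i) \<le> 1" by linarith
    then show ?thesis using D0 by (intro mult_left_mono) (auto intro: mult_left_le)
  qed
  finally show ?thesis by (simp add: m_def D_def)
qed

lemma Q_nonneg: "0 \<le> Q" using B C by (simp add: moment_bound_def)

lemma envelope_le: "B + C * (\<integral>\<omega>. x i \<omega> ^ 4 \<partial>W) \<le> Q"
  unfolding moment_bound_def using C by (intro add_left_mono mult_left_mono x4_le) auto

lemma z4_le: "(\<integral>\<omega>. z i \<omega> ^ 4 \<partial>W) \<le> Q"
  using fourth_moment_step(2)[OF integrable_x4] envelope_le by (rule order_trans)

lemma integrable_z2: "integrable W (\<lambda>\<omega>. (z i \<omega>)\<^sup>2)"
proof (rule integrable_dominated[where k=1 and i=i and j=i])
  fix \<omega> show "norm ((z i \<omega>)\<^sup>2) \<le> 1 * (1 + x i \<omega> ^ 4 + x i \<omega> ^ 4 + z i \<omega> ^ 4)"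
    unfolding real_norm_def mult_1_left abs_power2
    using power_le_one_plus_power4(2)[of "z i \<omega>"] power4_nonneg[of "x i \<omega>"] by linarith
qed measurable

lemma integrable_z3: "integrable W (\<lambda>\<omega>. \<bar>z i \<omega>\<bar> ^ 3)"
proof (rule integrable_dominated[where k=1 and i=i and j=i])
  fix \<omega> show "norm (\<bar>z i \<omega>\<bar> ^ 3) \<le> 1 * (1 + x i \<omega> ^ 4 + x i \<omega> ^ 4 + z i \<omega> ^ 4)"
    unfolding real_norm_def mult_1_left power_abs[symmetric] abs_abs
    using power_le_one_plus_power4(3)[of "z i \<omega>"] power4_nonneg[of "x i \<omega>"] unfolding power_abs by linarith
qed measurable

lemma z2_le: "(\<integral>\<omega>. (z i \<omega>)\<^sup>2 \<partial>W) \<le> 1 + Q"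
  and z3_le: "(\<integral>\<omega>. \<bar>z i \<omega>\<bar> ^ 3 \<partial>W) \<le> 1 + Q"
proof -
  have 1: "(\<integral>\<omega>. 1 + z i \<omega> ^ 4 \<partial>W) \<le> 1 + Q"
    using z4_le[of i] integrable_z4 by (simp add: prob_space)
  have "(\<integral>\<omega>. (z i \<omega>)\<^sup>2 \<partial>W) \<le> (\<integral>\<omega>. 1 + z i \<omega> ^ 4 \<partial>W)"
    using integrable_z2 integrable_z4 by (intro integral_mono power_le_one_plus_power4) auto
  then show "(\<integral>\<omega>. (z i \<omega>)\<^sup>2 \<partial>W) \<le> 1 + Q" using 1 by simp
  have "(\<integral>\<omega>. \<bar>z i \<omega>\<bar> ^ 3 \<partial>W) \<le> (\<integral>\<omega>. 1 + z i \<omega> ^ 4 \<partial>W)"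
    using integrable_z3 integrable_z4 by (intro integral_mono power_le_one_plus_power4) auto
  then show "(\<integral>\<omega>. \<bar>z i \<omega>\<bar> ^ 3 \<partial>W) \<le> 1 + Q" using 1 by simp
qed

lemma integrable_xx: "integrable W (\<lambda>\<omega>. x k \<omega> * x m \<omega>)"
proof (rule integrable_dominated[where k=1 and i=m and j=k])
  fix \<omega> show "norm (x k \<omega> * x m \<omega>) \<le> 1 * (1 + x k \<omega> ^ 4 + x m \<omega> ^ 4 + z m \<omega> ^ 4)"
    unfolding real_norm_def mult_1_left using power4_young(2)[of "x k \<omega>" "x m \<omega>"] power4_nonneg[of "z m \<omega>"] by linarith
qed measurable

lemma integrable_xz: "integrable W (\<lambda>\<omega>. x k \<omega> * z m \<omega>)"
proof (rule integrable_dominated[where k=1 and i=m and j=k])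
  fix \<omega> show "norm (x k \<omega> * z m \<omega>) \<le> 1 * (1 + x k \<omega> ^ 4 + x m \<omega> ^ 4 + z m \<omega> ^ 4)"
    unfolding real_norm_def mult_1_left using power4_young(2)[of "x k \<omega>" "z m \<omega>"] power4_nonneg[of "x m \<omega>"] by linarith
qed measurable

lemma integrable_diff2: "integrable W (\<lambda>\<omega>. (x m \<omega> - x k \<omega>)\<^sup>2)"
  using integrable_xx unfolding power2_eq_square by (auto simp: algebra_simps)

text \<open>Pythagoras for martingale increments: the cross term integrates to zero, and
  \<open>b_sq\<close> turns the remaining sum of squares into a telescoping one.\<close>

lemma increment_le:
  assumes "k \<le> m"
  shows "(\<integral>\<omega>. (x m \<omega> - x k \<omega>)\<^sup>2 \<partial>W) \<le> (1 + Q) * (1 / real (n + k) - 1 / real (n + m))"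
  using assms
proof (induction m rule: dec_induct)
  case base then show ?case by simp
next
  case (step m)
  have "x m \<in> borel_measurable (F m)" "x k \<in> borel_measurable (F m)" using x_F step by auto
  then have z: "(\<integral>\<omega>. (x m \<omega> - x k \<omega>) * z m \<omega> \<partial>W) = 0"
    using integrable_xz by (intro integral_mult_z) (auto simp: algebra_simps)
  have i: "integrable W (\<lambda>\<omega>. (x m \<omega> - x k \<omega>) * z m \<omega>)"
    using integrable_xz by (auto simp: algebra_simps)
  have "(\<integral>\<omega>. (x (Suc m) \<omega> - x k \<omega>)\<^sup>2 \<partial>W) =
     (\<integral>\<omega>. (x m \<omega> - x k \<omega>)\<^sup>2 + 2 * b m * ((x m \<omega> - x k \<omega>) * z m \<omega>) + (b m)\<^sup>2 * (z m \<omega>)\<^sup>2 \<partial>W)"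
    by (intro Bochner_Integration.integral_cong refl) (simp add: x_Suc power2_eq_square algebra_simps)
  also have "\<dots> = (\<integral>\<omega>. (x m \<omega> - x k \<omega>)\<^sup>2 \<partial>W) + (b m)\<^sup>2 * (\<integral>\<omega>. (z m \<omega>)\<^sup>2 \<partial>W)"
    using i integrable_diff2 integrable_z2 z by simp
  also have "\<dots> \<le> (1 + Q) * (1 / real (n + k) - 1 / real (n + m)) + (1 / real (n + m) - 1 / real (n + Suc m)) * (1 + Q)"
    using step.IH z2_le[of m] b_sq[of m] order_trans[OF zero_le_power2 b_sq[of m]]
    by (intro add_mono mult_mono) auto
  finally show ?case by (simp add: algebra_simps)
qed

end

section \<open>Almost sure convergence\<close>
text \<open>The values at the block ends converge because their increments are absolutely summable,
  and inside block \<open>k\<close> the sequence strays from the block start by at most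
  \<open>t k\<close>.\<close>

lemma convergent_blocks:
  fixes s :: "nat \<Rightarrow> real" and m :: "nat \<Rightarrow> nat"
  assumes m: "strict_mono m" and sum: "summable (\<lambda>k. \<bar>s (m (Suc k)) - s (m k)\<bar>)" and t: "t \<longlonglongrightarrow> 0"
    and bd: "\<And>k i. m k \<le> i \<Longrightarrow> i < m (Suc k) \<Longrightarrow> \<bar>s i - s (m k)\<bar> \<le> t k"
  shows "convergent s"
proof -
  have "summable (\<lambda>k. s (m (Suc k)) - s (m k))"
    using sum by (rule summable_rabs_cancel)
  then have "convergent (\<lambda>N. \<Sum>k<N. s (m (Suc k)) - s (m k))" by (simp add: summable_iff_convergent)
  then have "convergent (\<lambda>N. s (m N) - s (m 0))"
    by (simp add: sum_lessThan_telescope[of "\<lambda>k. s (m k)"])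
  then obtain l where "(\<lambda>N. s (m N) - s (m 0)) \<longlonglongrightarrow> l" by (auto simp: convergent_def)
  then have "(\<lambda>N. (s (m N) - s (m 0)) + s (m 0)) \<longlonglongrightarrow> l + s (m 0)" by (intro tendsto_intros)
  then have y: "(\<lambda>N. s (m N)) \<longlonglongrightarrow> l + s (m 0)" by simp
  have "s \<longlonglongrightarrow> l + s (m 0)"
  proof (rule LIMSEQ_I)
    fix r :: real assume r: "0 < r"
    obtain k1 where k1: "\<And>k. k \<ge> k1 \<Longrightarrow> \<bar>s (m k) - (l + s (m 0))\<bar> < r / 2"
      using LIMSEQ_D[OF y, of "r / 2"] r by auto
    obtain k2 where k2: "\<And>k. k \<ge> k2 \<Longrightarrow> \<bar>t k\<bar> < r / 2"
      using LIMSEQ_D[OF t, of "r / 2"] r by auto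
    have "norm (s i - (l + s (m 0))) < r" if i: "i \<ge> m (max k1 k2)" for i
    proof -
      \<comment> \<open>The index of the block containing \<open>i\<close>. Minimality gives
        \<open>m k \<le> i\<close> except when \<open>k\<close> is 0, where the lower bound comes
        from the choice of \<open>i\<close>.\<close>
      define k where "k = (LEAST k. i < m (Suc k))"
      have "i < m (Suc i)" using strict_mono_imp_increasing[OF m, of "Suc i"] by simp
      then have k: "i < m (Suc k)" unfolding k_def by (rule LeastI)
      have le: "m k \<le> i"
      proof (cases k)
        case 0
        then show ?thesis using i strict_mono_less_eq[OF m, of 0 "max k1 k2"] by simp
      next
        case (Suc k')
        then have "\<not> i < m (Suc k')" using not_less_Least[of k' "\<lambda>k. i < m (Suc k)"] by (simp add: k_def)
        then show ?thesis using Suc by simp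
      qed
      have "m (max k1 k2) < m (Suc k)" using i k by simp
      then have "max k1 k2 < Suc k" using strict_mono_less[OF m] by blast
      then have "k1 \<le> k" "k2 \<le> k" by auto
      then show ?thesis using k1[of k] k2[of k] bd[OF le k] unfolding real_norm_def by linarith
    qed
    then show "\<exists>no. \<forall>n\<ge>no. norm (s n - (l + s (m 0))) < r" by blast
  qed
  then show ?thesis by (auto simp: convergent_def)
qed

text \<open>By monotone convergence the sum has finite expectation, hence is finite almost
  surely.\<close>

lemma (in prob_space) AE_summable:
  fixes f :: "nat \<Rightarrow> 'a \<Rightarrow> real"
  assumes int: "\<And>k. integrable M (f k)" and nonneg: "\<And>k \<omega>. 0 \<le> f k \<omega>"
    and le: "\<And>k. (\<integral>\<omega>. f k \<omega> \<partial>M) \<le> a k" and a: "summable a"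
  shows "AE \<omega> in M. summable (\<lambda>k. f k \<omega>)"
proof -
  have m: "f k \<in> borel_measurable M" for k using int by auto
  have a0: "0 \<le> a k" for k using order_trans[OF Bochner_Integration.integral_nonneg le[of k]] nonneg by auto
  have "(\<integral>\<^sup>+\<omega>. (\<Sum>k. ennreal (f k \<omega>)) \<partial>M) = (\<Sum>k. \<integral>\<^sup>+\<omega>. ennreal (f k \<omega>) \<partial>M)"
    using m by (intro nn_integral_suminf) auto
  also have "\<dots> = (\<Sum>k. ennreal (\<integral>\<omega>. f k \<omega> \<partial>M))"
    using int nonneg by (intro suminf_cong nn_integral_eq_integral) auto
  also have "\<dots> \<le> (\<Sum>k. ennreal (a k))"
    using le by (intro suminf_le) (auto intro: ennreal_leI)
  also have "\<dots> < \<infinity>" using suminf_ennreal2[OF a0 a] by (simp add: less_top[symmetric])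
  finally have "AE \<omega> in M. (\<Sum>k. ennreal (f k \<omega>)) \<noteq> \<infinity>"
    using m by (intro nn_integral_noteq_infinite) auto
  then show ?thesis
  proof eventually_elim
    case (elim \<omega>)
    then show ?case using nonneg by (intro summable_suminf_not_top) auto
  qed
qed

text \<open>
  Blocks between consecutive cubes make an elementary proof of almost sure convergence possible:
  a block of length \<open>O(k\<^sup>2)\<close> with steps \<open>O(k^(-3))\<close> has square-summable total variation, and the
  increments of the row over the blocks are absolutely summable.
\<close>

lemma summable_inverse_Suc_sq: "summable (\<lambda>k. 1 / (real k + 1)\<^sup>2)"
proof -
  have "summable (\<lambda>k. inverse (real (Suc k) ^ 2))"
    using inverse_power_summable[of 2, where 'a=real] by (subst summable_Suc_iff) simp
  moreover have "(\<lambda>k. inverse (real (Suc k) ^ 2)) = (\<lambda>k. 1 / (real k + 1)\<^sup>2)"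
    by (simp add: inverse_eq_divide add.commute)
  ultimately show ?thesis by simp
qed

text \<open>The exponent 3 makes both block estimates below multiples of 1/(k+1)^2. The shift by 1
  keeps the block starts positive, as \<open>b_le\<close> requires.\<close>

definition cube :: "nat \<Rightarrow> nat" where "cube k = (k + 1) ^ 3"

lemma real_cube: "real (cube k) = (real k + 1) ^ 3"
  by (simp add: cube_def add.commute)

lemma cube_pos: "0 < cube k"
  by (simp add: cube_def)

lemma strict_mono_cube: "strict_mono cube"
  unfolding cube_def by (intro strict_monoI power_strict_mono) auto

lemma cube_mono: "cube k \<le> cube (Suc k)"
  using strict_mono_less_eq[OF strict_mono_cube] by simp

lemma cube_diff_le: "real (cube (Suc k) - cube k) \<le> 7 * (real k + 1)\<^sup>2"
proof -
  have "real (cube (Suc k) - cube k) = (real k + 2) ^ 3 - (real k + 1) ^ 3"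
    using cube_mono by (subst of_nat_diff) (simp_all add: real_cube add_ac)
  also have "\<dots> \<le> 7 * (real k + 1)\<^sup>2"
    by (simp add: power3_eq_cube power2_eq_square algebra_simps)
  finally show ?thesis .
qed

context adapted_recursion
begin

lemma b_le: "k \<le> i \<Longrightarrow> 0 < k \<Longrightarrow> b i \<le> 1 / real k"
  unfolding b_def by (simp add: field_simps)

lemma AE_summable_blocks: "AE \<omega> in W. summable (\<lambda>k. \<bar>x (cube (Suc k)) \<omega> - x (cube k) \<omega>\<bar>)"
proof (rule AE_summable[where a="\<lambda>k. (1 + 7 * (1 + Q)) * (1 / (real k + 1)\<^sup>2)"])
  fix k
  let ?j = "cube k" and ?m = "cube (Suc k)" and ?K = "real k + 1"
  let ?D = "\<lambda>\<omega>. x ?m \<omega> - x ?j \<omega>"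
  have i2: "integrable W (\<lambda>\<omega>. (?D \<omega>)\<^sup>2)" by (rule integrable_diff2)
  \<comment> \<open>The weight is chosen to balance the two terms: the second moment of the block
    increment is of order K^(-4), so both contribute order K^(-2) in the mean.\<close>
  have bd: "\<bar>?D \<omega>\<bar> \<le> 1 / ?K\<^sup>2 + ?K\<^sup>2 * (?D \<omega>)\<^sup>2" for \<omega>
  proof -
    have "2 * (1 / ?K) * (?K * \<bar>?D \<omega>\<bar>) \<le> (1 / ?K)\<^sup>2 + (?K * \<bar>?D \<omega>\<bar>)\<^sup>2" by (rule sum_squares_bound)
    then have "2 * \<bar>?D \<omega>\<bar> \<le> 1 / ?K\<^sup>2 + ?K\<^sup>2 * (?D \<omega>)\<^sup>2" by (simp add: power_divide power_mult_distrib)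
    moreover have "a \<le> s" if "2 * a \<le> s" "0 \<le> a" for a s :: real using that by linarith
    ultimately show ?thesis by (meson abs_ge_zero)
  qed
  show i1: "integrable W (\<lambda>\<omega>. \<bar>?D \<omega>\<bar>)"
  proof (rule Bochner_Integration.integrable_bound)
    show "integrable W (\<lambda>\<omega>. 1 / ?K\<^sup>2 + ?K\<^sup>2 * (?D \<omega>)\<^sup>2)" using i2 by simp
    show "AE \<omega> in W. norm \<bar>?D \<omega>\<bar> \<le> norm (1 / ?K\<^sup>2 + ?K\<^sup>2 * (?D \<omega>)\<^sup>2)"
      using bd by (intro AE_I2) (simp add: order_trans[OF _ abs_ge_self])
  qed measurable
  have "(\<integral>\<omega>. (?D \<omega>)\<^sup>2 \<partial>W) \<le> (1 + Q) * (7 * ?K\<^sup>2 / (?K ^ 3 * ?K ^ 3))"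
  proof -
    have "(\<integral>\<omega>. (?D \<omega>)\<^sup>2 \<partial>W) \<le> (1 + Q) * (1 / real (n + ?j) - 1 / real (n + ?m))"
      by (rule increment_le[OF cube_mono])
    also have "1 / real (n + ?j) - 1 / real (n + ?m) = real (?m - ?j) / (real (n + ?j) * real (n + ?m))"
    proof -
      have "1 / p - 1 / q = (q - p) / (p * q)" if "0 < p" "0 < q" for p q :: real
        using that by (simp add: field_simps)
      moreover have "0 < real (n + ?j)" "0 < real (n + ?m)" using n by auto
      moreover have "real (n + ?m) - real (n + ?j) = real (?m - ?j)" using cube_mono[of k] by (simp add: of_nat_diff)
      ultimately show ?thesis by presburger
    qed
    also have "\<dots> \<le> (7 * ?K\<^sup>2) / (?K ^ 3 * ?K ^ 3)"
    proof (intro frac_le mult_mono)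
      have j: "real ?j = ?K ^ 3" by (rule real_cube)
      show "?K ^ 3 \<le> real (n + ?j)" using j by simp
      show "?K ^ 3 \<le> real (n + ?m)" using j of_nat_mono[OF cube_mono[of k], where 'a=real]
        unfolding of_nat_add by linarith
    qed (use cube_diff_le[of k] in auto)
    finally show ?thesis using Q_nonneg by (simp add: mult_left_mono)
  qed
  then have D2: "?K\<^sup>2 * (\<integral>\<omega>. (?D \<omega>)\<^sup>2 \<partial>W) \<le> ?K\<^sup>2 * ((1 + Q) * (7 * ?K\<^sup>2 / (?K ^ 3 * ?K ^ 3)))"
    by (intro mult_left_mono) auto
  have "?K > 0" by simp
  then have eq: "?K\<^sup>2 * ((1 + Q) * (7 * ?K\<^sup>2 / (?K ^ 3 * ?K ^ 3))) = 7 * (1 + Q) * (1 / ?K\<^sup>2)"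
    by (simp add: power2_eq_square power3_eq_cube divide_simps) (simp add: algebra_simps)
  have "(\<integral>\<omega>. \<bar>?D \<omega>\<bar> \<partial>W) \<le> (\<integral>\<omega>. 1 / ?K\<^sup>2 + ?K\<^sup>2 * (?D \<omega>)\<^sup>2 \<partial>W)"
    using i1 i2 bd by (intro integral_mono) auto
  also have "\<dots> = 1 / ?K\<^sup>2 + ?K\<^sup>2 * (\<integral>\<omega>. (?D \<omega>)\<^sup>2 \<partial>W)" using i2 by (simp add: prob_space)
  also have "\<dots> \<le> (1 + 7 * (1 + Q)) * (1 / ?K\<^sup>2)"
  proof -
    have "p + r \<le> (1 + w) * p" if "r \<le> w * p" for p r w :: real using that by (simp add: distrib_right)
    then show ?thesis using D2 unfolding eq .
  qed
  finally show "(\<integral>\<omega>. \<bar>?D \<omega>\<bar> \<partial>W) \<le> (1 + 7 * (1 + Q)) * (1 / ?K\<^sup>2)" .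
next
  show "summable (\<lambda>k. (1 + 7 * (1 + Q)) * (1 / (real k + 1)\<^sup>2))"
    by (intro summable_mult summable_inverse_Suc_sq)
qed simp

text \<open>Cauchy-Schwarz over a block costs its length, at most 7 K^2 with K = k + 1; the sum of
  squares has again at most 7 K^2 terms, each of mean at most (1 + Q) K^(-6). Hence 49 (1 + Q) /
  K^2.\<close>

lemma AE_summable_block_sums:
  "AE \<omega> in W. summable (\<lambda>k. (\<Sum>i\<in>{cube k..<cube (Suc k)}. b i * \<bar>z i \<omega>\<bar>)\<^sup>2)"
proof (rule AE_summable[where a="\<lambda>k. (49 * (1 + Q)) * (1 / (real k + 1)\<^sup>2)"])
  fix k
  let ?I = "{cube k..<cube (Suc k)}" and ?K = "real k + 1"
  have cs: "(\<Sum>i\<in>?I. b i * \<bar>z i \<omega>\<bar>)\<^sup>2 \<le> real (card ?I) * (\<Sum>i\<in>?I. (b i)\<^sup>2 * (z i \<omega>)\<^sup>2)" for \<omega>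
    using sum_squared_le_sum_of_squares[of "\<lambda>i. b i * \<bar>z i \<omega>\<bar>" ?I]
    by (simp add: power_mult_distrib mult.commute)
  have i1: "integrable W (\<lambda>\<omega>. real (card ?I) * (\<Sum>i\<in>?I. (b i)\<^sup>2 * (z i \<omega>)\<^sup>2))"
    using integrable_z2 by (intro integrable_mult_right Bochner_Integration.integrable_sum) auto
  show i2: "integrable W (\<lambda>\<omega>. (\<Sum>i\<in>?I. b i * \<bar>z i \<omega>\<bar>)\<^sup>2)"
    by (rule Bochner_Integration.integrable_bound[OF i1])
       (use order_trans[OF cs abs_ge_self] in auto)
  have "(\<integral>\<omega>. (\<Sum>i\<in>?I. b i * \<bar>z i \<omega>\<bar>)\<^sup>2 \<partial>W) \<le> (\<integral>\<omega>. real (card ?I) * (\<Sum>i\<in>?I. (b i)\<^sup>2 * (z i \<omega>)\<^sup>2) \<partial>W)"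
    by (intro integral_mono i1 i2 cs)
  also have "\<dots> = real (card ?I) * (\<Sum>i\<in>?I. (b i)\<^sup>2 * (\<integral>\<omega>. (z i \<omega>)\<^sup>2 \<partial>W))"
    using integrable_z2 by simp
  also have "\<dots> \<le> real (card ?I) * (\<Sum>i\<in>?I. (1 / ?K ^ 3)\<^sup>2 * (1 + Q))"
  proof (intro mult_left_mono sum_mono mult_mono power_mono)
    fix i assume "i \<in> ?I"
    then show "b i \<le> 1 / ?K ^ 3" using b_le[of "cube k" i] by (simp add: real_cube cube_pos)
  qed (use b_pos z2_le in \<open>auto simp: less_imp_le\<close>)
  also have "\<dots> = real (card ?I) * real (card ?I) * ((1 / ?K ^ 3)\<^sup>2 * (1 + Q))" by simp
  also have "\<dots> \<le> (7 * ?K\<^sup>2) * (7 * ?K\<^sup>2) * ((1 / ?K ^ 3)\<^sup>2 * (1 + Q))"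
    using cube_diff_le[of k] Q_nonneg by (intro mult_right_mono mult_mono) auto
  also have "?K > 0" by simp
  then have "(7 * ?K\<^sup>2) * (7 * ?K\<^sup>2) * ((1 / ?K ^ 3)\<^sup>2 * (1 + Q)) = (49 * (1 + Q)) * (1 / ?K\<^sup>2)"
    by (simp add: power2_eq_square power3_eq_cube divide_simps)
  finally show "(\<integral>\<omega>. (\<Sum>i\<in>?I. b i * \<bar>z i \<omega>\<bar>)\<^sup>2 \<partial>W) \<le> (49 * (1 + Q)) * (1 / ?K\<^sup>2)" .
next
  show "summable (\<lambda>k. (49 * (1 + Q)) * (1 / (real k + 1)\<^sup>2))"
    by (intro summable_mult summable_inverse_Suc_sq)
qed simp

lemma increment_abs_le: "j \<le> i \<Longrightarrow> \<bar>x i \<omega> - x j \<omega>\<bar> \<le> (\<Sum>l\<in>{j..<i}. b l * \<bar>z l \<omega>\<bar>)"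
proof (induction i rule: dec_induct)
  case (step m)
  then have s: "{j..<Suc m} = insert m {j..<m}" by auto
  have "\<bar>x (Suc m) \<omega> - x j \<omega>\<bar> \<le> \<bar>x m \<omega> - x j \<omega>\<bar> + \<bar>b m * z m \<omega>\<bar>" by (simp add: x_Suc)
  then show ?case using step b_pos[of m] unfolding s by (simp add: abs_mult)
qed simp

theorem AE_convergent: "AE \<omega> in W. convergent (\<lambda>i. x i \<omega>)"
  using AE_summable_blocks AE_summable_block_sums
proof eventually_elim
  case (elim \<omega>)
  let ?t = "\<lambda>k. \<Sum>i\<in>{cube k..<cube (Suc k)}. b i * \<bar>z i \<omega>\<bar>"
  have t0: "0 \<le> ?t k" for k using b_pos by (intro sum_nonneg) (auto simp: less_imp_le)
  have "(\<lambda>k. sqrt ((?t k)\<^sup>2)) \<longlonglongrightarrow> sqrt 0"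
    using summable_LIMSEQ_zero[OF elim(2)] by (rule tendsto_real_sqrt)
  then have "?t \<longlonglongrightarrow> 0" using t0 by simp
  then show ?case
  proof (rule convergent_blocks[OF strict_mono_cube elim(1)])
    fix k i :: nat assume ki: "cube k \<le> i" "i < cube (Suc k)"
    have "\<bar>x i \<omega> - x (cube k) \<omega>\<bar> \<le> (\<Sum>l\<in>{cube k..<i}. b l * \<bar>z l \<omega>\<bar>)"
      using ki by (intro increment_abs_le)
    also have "\<dots> \<le> ?t k" using ki b_pos by (intro sum_mono2) (auto simp: less_imp_le)
    finally show "\<bar>x i \<omega> - x (cube k) \<omega>\<bar> \<le> ?t k" .
  qed
qed

end

section \<open>Characteristic functions\<close>

lemma iexp_remainder:
  "cmod (iexp t - (1 + \<i> * t - complex_of_real (t\<^sup>2 / 2))) \<le> \<bar>t\<bar> ^ 3 / 6"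
  using iexp_approx1[of t 2]
  by (simp add: fact_numeral numeral_eq_Suc power2_eq_square algebra_simps)

text \<open>The lower bound is convexity of \<open>exp\<close>. For the upper one, the difference
  has derivative t - 1 + exp(-t), which is non-negative by the same convexity bound.\<close>

lemma exp_remainder:
  fixes y :: real assumes "0 \<le> y" shows "\<bar>exp (- y) - (1 - y)\<bar> \<le> y\<^sup>2 / 2"
proof -
  have "1 - y \<le> exp (- y)" using exp_ge_add_one_self[of "- y"] by simp
  moreover have "exp (- y) \<le> 1 - y + y\<^sup>2 / 2"
  proof -
    have *: "(\<lambda>t. 1 - t + t\<^sup>2 / 2 - exp (- t)) 0 \<le> (\<lambda>t. 1 - t + t\<^sup>2 / 2 - exp (- t)) y"
    proof (rule DERIV_nonneg_imp_nondecreasing[OF assms])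
      fix t :: real
      have "((\<lambda>t. 1 - t + t\<^sup>2 / 2 - exp (- t)) has_real_derivative (t - 1 + exp (- t))) (at t)"
        by (auto intro!: derivative_eq_intros)
      moreover have "0 \<le> t - 1 + exp (- t)" using exp_ge_add_one_self[of "- t"] by simp
      ultimately show "\<exists>d. ((\<lambda>t. 1 - t + t\<^sup>2 / 2 - exp (- t)) has_real_derivative d) (at t) \<and> 0 \<le> d" by blast
    qed
    then show ?thesis by simp
  qed
  ultimately show ?thesis by linarith
qed

context adapted_recursion
begin

section \<open>Mean deviation of the conditional variance, and the one-step comparison\<close>

lemma integrable_g_diff: "integrable W (\<lambda>\<omega>. \<bar>g (x i \<omega>) - v\<bar>)"
proof (rule Bochner_Integration.integrable_bound)
  show "integrable W (\<lambda>\<omega>. 1 + (B + C * x i \<omega> ^ 4) + \<bar>v\<bar>)" using integrable_x4 by auto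
  show "AE \<omega> in W. norm \<bar>g (x i \<omega>) - v\<bar> \<le> norm (1 + (B + C * x i \<omega> ^ 4) + \<bar>v\<bar>)"
    using x_T[of i]
  proof eventually_elim
    case (elim \<omega>)
    have "\<bar>g (x i \<omega>)\<bar> \<le> 1 + (g (x i \<omega>))\<^sup>2"
      using sum_squares_bound[of 1 "\<bar>g (x i \<omega>)\<bar>"] by simp
    then show ?case using g_le[OF elim] by simp
  qed
qed measurable

text \<open>
  Away from \<open>s\<close>, the inequality \<open>w \<le> \<eta> w\<^sup>2 + 1 / (4 \<eta>)\<close> trades the unbounded \<open>g\<close> for its square,
  and Chebyshev's inequality is applied to the constant; this replaces uniform integrability.
\<close>

lemma integral_g_diff_le:
  assumes "0 < \<delta>" "0 < \<eta>" "0 \<le> \<epsilon>"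
    and close: "\<And>t. t \<in> T \<Longrightarrow> \<bar>t - s\<bar> < \<delta> \<Longrightarrow> \<bar>g t - v\<bar> \<le> \<epsilon>"
  shows "(\<integral>\<omega>. \<bar>g (x i \<omega>) - v\<bar> \<partial>W) \<le>
     \<epsilon> + 2 * \<eta> * (Q + v\<^sup>2) + (2 * (1 + Q) / real n + 2 * (c - s)\<^sup>2) / (\<eta> * \<delta>\<^sup>2)"
proof -
  have pt: "\<bar>g t - v\<bar> \<le> \<epsilon> + 2 * \<eta> * ((B + C * t ^ 4) + v\<^sup>2) + (t - s)\<^sup>2 / (\<eta> * \<delta>\<^sup>2)" if t: "t \<in> T" for t
  proof -
    have nn: "0 \<le> 2 * \<eta> * ((B + C * t ^ 4) + v\<^sup>2)" "0 \<le> (t - s)\<^sup>2 / (\<eta> * \<delta>\<^sup>2)"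
      using assms B C by auto
    show ?thesis
    proof (cases "\<bar>t - s\<bar> < \<delta>")
      case True then show ?thesis using close[OF t] nn by linarith
    next
      case False
      \<comment> \<open>Chebyshev in pointwise form: off the \<delta>-neighbourhood the constant
        1/\<eta> is at most (t - s)^2 / (\<eta> \<delta>^2), whose mean is controlled along the
        row.\<close>
      then have "\<delta>\<^sup>2 \<le> (t - s)\<^sup>2" using assms(1) by (simp add: abs_le_square_iff[symmetric])
      then have "1 / \<eta> \<le> ((t - s)\<^sup>2 / \<delta>\<^sup>2) / \<eta>" using assms by (intro divide_right_mono) auto
      also have "\<dots> = (t - s)\<^sup>2 / (\<eta> * \<delta>\<^sup>2)" by (simp add: mult.commute)
      finally have 1: "1 / \<eta> \<le> (t - s)\<^sup>2 / (\<eta> * \<delta>\<^sup>2)" .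
      let ?w = "\<bar>g t - v\<bar>"
      have "2 * (\<eta> * ?w) * 1 \<le> (\<eta> * ?w)\<^sup>2 + 1\<^sup>2" by (rule sum_squares_bound)
      then have "(2 * (\<eta> * ?w)) / \<eta> \<le> ((\<eta> * ?w)\<^sup>2 + 1) / \<eta>" using assms by (intro divide_right_mono) auto
      then have 2: "2 * ?w \<le> \<eta> * (g t - v)\<^sup>2 + 1 / \<eta>"
      proof -
        have "((\<eta> * w)\<^sup>2 + 1) / \<eta> = \<eta> * w\<^sup>2 + 1 / \<eta>" for w
          using assms by (simp add: field_simps power2_eq_square)
        from this[of ?w] show ?thesis using \<open>(2 * (\<eta> * ?w)) / \<eta> \<le> _\<close> assms unfolding power2_abs by simp
      qed
      have "(g t - v)\<^sup>2 \<le> 2 * ((g t)\<^sup>2 + v\<^sup>2)"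
        using sum_squares_bound[of "g t" "- v"] by (simp add: power2_diff)
      also have "\<dots> \<le> 2 * ((B + C * t ^ 4) + v\<^sup>2)" using g_le[OF t] by simp
      finally have "\<eta> * (g t - v)\<^sup>2 \<le> \<eta> * (2 * ((B + C * t ^ 4) + v\<^sup>2))"
        using assms by (intro mult_left_mono) auto
      then have 3: "\<eta> * (g t - v)\<^sup>2 \<le> 2 * \<eta> * ((B + C * t ^ 4) + v\<^sup>2)" by (simp only: mult.assoc mult.left_commute)
      have "w \<le> \<epsilon> + p + r" if "0 \<le> w" "k \<le> r" "2 * w \<le> q + k" "q \<le> p" for w k q p r :: real
        using that assms(3) by linarith
      from this[OF abs_ge_zero 1 2 3] show ?thesis .
    qed
  qed
  have i2: "integrable W (\<lambda>\<omega>. (x i \<omega> - s)\<^sup>2)"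
  proof -
    have "integrable W (\<lambda>\<omega>. x i \<omega>)"
    proof (rule integrable_dominated[where k=1 and i=i and j=i])
      fix \<omega> show "norm (x i \<omega>) \<le> 1 * (1 + x i \<omega> ^ 4 + x i \<omega> ^ 4 + z i \<omega> ^ 4)"
        unfolding real_norm_def mult_1_left
        using power_le_one_plus_power4(1)[of "x i \<omega>"] power4_nonneg[of "x i \<omega>"] power4_nonneg[of "z i \<omega>"] by linarith
    qed measurable
    then show ?thesis using integrable_xx[of i i] by (simp add: power2_eq_square algebra_simps)
  qed
  have "(\<integral>\<omega>. (x i \<omega> - c)\<^sup>2 \<partial>W) \<le> (1 + Q) * (1 / real n - 1 / real (n + i))"
    using increment_le[of 0 i] by (simp add: x_0)
  also have "\<dots> \<le> (1 + Q) * (1 / real n)" using Q_nonneg by (intro mult_left_mono) auto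
  finally have inc: "(\<integral>\<omega>. (x i \<omega> - c)\<^sup>2 \<partial>W) \<le> (1 + Q) / real n" by simp
  have ic: "integrable W (\<lambda>\<omega>. (x i \<omega> - c)\<^sup>2)" using integrable_diff2[of i 0] by (simp add: x_0)
  \<comment> \<open>The distance to \<open>s\<close> is split into the movement of the row, of mean
    square at most (1 + Q)/n, and the deterministic error of its starting point.\<close>
  have "(\<integral>\<omega>. (x i \<omega> - s)\<^sup>2 \<partial>W) \<le> (\<integral>\<omega>. 2 * (x i \<omega> - c)\<^sup>2 + 2 * (c - s)\<^sup>2 \<partial>W)"
  proof (rule integral_mono)
    fix \<omega> show "(x i \<omega> - s)\<^sup>2 \<le> 2 * (x i \<omega> - c)\<^sup>2 + 2 * (c - s)\<^sup>2"
      using sum_squares_bound[of "x i \<omega> - c" "c - s"] power2_sum[of "x i \<omega> - c" "c - s"] by simp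
  qed (use i2 ic in auto)
  also have "\<dots> = 2 * (\<integral>\<omega>. (x i \<omega> - c)\<^sup>2 \<partial>W) + 2 * (c - s)\<^sup>2" using ic by (simp add: prob_space)
  also have "\<dots> \<le> 2 * ((1 + Q) / real n) + 2 * (c - s)\<^sup>2" using inc by (intro add_right_mono mult_left_mono) auto
  also have "\<dots> = 2 * (1 + Q) / real n + 2 * (c - s)\<^sup>2" by simp
  finally have dist: "(\<integral>\<omega>. (x i \<omega> - s)\<^sup>2 \<partial>W) \<le> 2 * (1 + Q) / real n + 2 * (c - s)\<^sup>2" .
  have "(\<integral>\<omega>. \<bar>g (x i \<omega>) - v\<bar> \<partial>W) \<le>
     (\<integral>\<omega>. \<epsilon> + 2 * \<eta> * ((B + C * x i \<omega> ^ 4) + v\<^sup>2) + (x i \<omega> - s)\<^sup>2 / (\<eta> * \<delta>\<^sup>2) \<partial>W)"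
    using integrable_g_diff integrable_x4 i2 x_T[of i] by (intro integral_mono_AE) (auto intro: pt elim: AE_mp)
  also have "\<dots> = \<epsilon> + 2 * \<eta> * ((B + C * (\<integral>\<omega>. x i \<omega> ^ 4 \<partial>W)) + v\<^sup>2) + (\<integral>\<omega>. (x i \<omega> - s)\<^sup>2 \<partial>W) / (\<eta> * \<delta>\<^sup>2)"
    using integrable_x4 i2 by (simp add: prob_space)
  also have "\<dots> \<le> \<epsilon> + 2 * \<eta> * (Q + v\<^sup>2) + (2 * (1 + Q) / real n + 2 * (c - s)\<^sup>2) / (\<eta> * \<delta>\<^sup>2)"
    using envelope_le[of i] dist assms
    by (intro add_mono mult_left_mono divide_right_mono) auto
  finally show ?thesis .
qed

text \<open>The exponential depends on \<open>x i\<close> alone and so is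
  \<open>F i\<close>-measurable; its cosine and sine parts are treated separately because
  \<open>integral_mult_z\<close> is real.\<close>

lemma integral_iexp_z:
  fixes u :: real
  shows "integrable W (\<lambda>\<omega>. iexp (u * (x i \<omega> - c)) * complex_of_real (z i \<omega>))"
    and "(\<integral>\<omega>. iexp (u * (x i \<omega> - c)) * complex_of_real (z i \<omega>) \<partial>W) = 0"
proof -
  let ?f = "\<lambda>\<omega>. iexp (u * (x i \<omega> - c)) * complex_of_real (z i \<omega>)"
  have xF[measurable]: "x i \<in> borel_measurable (F i)" using x_F by simp
  show int: "integrable W ?f"
  proof (rule integrable_dominated[where k=1 and i=i and j=i])
    fix \<omega> show "norm (?f \<omega>) \<le> 1 * (1 + x i \<omega> ^ 4 + x i \<omega> ^ 4 + z i \<omega> ^ 4)"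
      unfolding norm_mult norm_exp_i_times norm_of_real mult_1_left
      using power_le_one_plus_power4(1)[of "z i \<omega>"] power4_nonneg[of "x i \<omega>"] by linarith
  qed measurable
  have Re: "Re (?f \<omega>) = cos (u * (x i \<omega> - c)) * z i \<omega>" and Im: "Im (?f \<omega>) = sin (u * (x i \<omega> - c)) * z i \<omega>" for \<omega>
    unfolding cis_conv_exp[symmetric] by simp_all
  have "Re (integral\<^sup>L W ?f) = (\<integral>\<omega>. cos (u * (x i \<omega> - c)) * z i \<omega> \<partial>W)"
    using integral_Re[OF int] unfolding Re by simp
  also have "\<dots> = 0" using integrable_Re[OF int] unfolding Re by (intro integral_mult_z) auto
  finally have 1: "Re (integral\<^sup>L W ?f) = 0" .
  have "Im (integral\<^sup>L W ?f) = (\<integral>\<omega>. sin (u * (x i \<omega> - c)) * z i \<omega> \<partial>W)"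
    using integral_Im[OF int] unfolding Im by simp
  also have "\<dots> = 0" using integrable_Im[OF int] unfolding Im by (intro integral_mult_z) auto
  finally show "integral\<^sup>L W ?f = 0" using 1 by (simp add: complex_eq_iff)
qed

lemma integral_iexp_z2:
  fixes u v :: real
  shows "integrable W (\<lambda>\<omega>. iexp (u * (x i \<omega> - c)) * complex_of_real ((z i \<omega>)\<^sup>2 - v))"
    and "cmod (\<integral>\<omega>. iexp (u * (x i \<omega> - c)) * complex_of_real ((z i \<omega>)\<^sup>2 - v) \<partial>W) \<le> (\<integral>\<omega>. \<bar>g (x i \<omega>) - v\<bar> \<partial>W)"
proof -
  let ?e = "\<lambda>\<omega>. iexp (u * (x i \<omega> - c))"
  let ?f = "\<lambda>\<omega>. ?e \<omega> * complex_of_real ((z i \<omega>)\<^sup>2 - v)"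
  let ?g = "\<lambda>\<omega>. ?e \<omega> * complex_of_real (g (x i \<omega>) - v)"
  have xF[measurable]: "x i \<in> borel_measurable (F i)" using x_F by simp
  have int0: "integrable W (\<lambda>\<omega>. (z i \<omega>)\<^sup>2 - v)" using integrable_z2 by auto
  show int: "integrable W ?f"
    by (rule Bochner_Integration.integrable_bound[OF int0])
       (auto simp del: of_real_diff of_real_power of_real_mult simp: norm_mult)
  have intg: "integrable W ?g"
    by (rule Bochner_Integration.integrable_bound[OF integrable_g_diff[of i v]])
       (auto simp del: of_real_diff of_real_power of_real_mult simp: norm_mult)
  have h: "(\<integral>\<omega>. h \<omega> * ((z i \<omega>)\<^sup>2 - v) \<partial>W) = (\<integral>\<omega>. h \<omega> * (g (x i \<omega>) - v) \<partial>W)"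
    if hF: "h \<in> borel_measurable (F i)" and h1: "\<And>\<omega>. \<bar>h \<omega>\<bar> \<le> 1" for h
  proof -
    have [measurable]: "h \<in> borel_measurable W" using hF subalg measurable_from_subalg by blast
    have bounded: "integrable W (\<lambda>\<omega>. h \<omega> * k \<omega>)" if k: "integrable W k" for k
      using h1 borel_measurable_integrable[OF k]
      by (intro Bochner_Integration.integrable_bound[OF k]) (auto simp: abs_mult mult_left_le_one_le)
    have "integrable W (\<lambda>\<omega>. h \<omega> * 1)" by (rule bounded) simp
    moreover have "integrable W (\<lambda>\<omega>. h \<omega> * g (x i \<omega>))"
    proof (rule bounded)
      show "integrable W (\<lambda>\<omega>. g (x i \<omega>))"
        using integrable_g_diff[of i 0] by (subst (asm) integrable_abs_iff) auto
    qed
    ultimately show ?thesis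
      using integral_mult_z2[OF hF] bounded[OF integrable_z2] by (simp add: right_diff_distrib)
  qed
  have Re: "Re (?e \<omega> * complex_of_real a) = cos (u * (x i \<omega> - c)) * a"
    and Im: "Im (?e \<omega> * complex_of_real a) = sin (u * (x i \<omega> - c)) * a" for \<omega> a
    unfolding cis_conv_exp[symmetric] by simp_all
  have "Re (integral\<^sup>L W ?f) = Re (integral\<^sup>L W ?g)"
    unfolding integral_Re[OF int, symmetric] integral_Re[OF intg, symmetric] Re by (rule h) auto
  moreover have "Im (integral\<^sup>L W ?f) = Im (integral\<^sup>L W ?g)"
    unfolding integral_Im[OF int, symmetric] integral_Im[OF intg, symmetric] Im by (rule h) auto
  ultimately have "integral\<^sup>L W ?f = integral\<^sup>L W ?g" by (simp add: complex_eq_iff)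
  then have "cmod (integral\<^sup>L W ?f) = cmod (integral\<^sup>L W ?g)" by (rule arg_cong)
  also have "\<dots> \<le> (\<integral>\<omega>. cmod (?g \<omega>) \<partial>W)" by (rule integral_norm_bound)
  also have "\<dots> = (\<integral>\<omega>. \<bar>g (x i \<omega>) - v\<bar> \<partial>W)"
    unfolding norm_mult norm_exp_i_times norm_of_real mult_1_left ..
  finally show "cmod (integral\<^sup>L W ?f) \<le> (\<integral>\<omega>. \<bar>g (x i \<omega>) - v\<bar> \<partial>W)" .
qed

lemma integrable_iexp_x: "integrable W (\<lambda>\<omega>. iexp (u * (x i \<omega> - c)))"
  by (intro integrable_const_bound[where B=1]) auto

text \<open>With y = q^2 v / 2, both iexp(q z) and exp(-y) are expanded to second order in q. The
  constants cancel, the linear term integrates to zero, the quadratic terms leave z^2 - v, and the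
  bound collects this discrepancy, the cubic remainder and y^2 / 2.\<close>

lemma char_step:
  fixes u v e :: real
  assumes v: "0 \<le> v" and e: "(\<integral>\<omega>. \<bar>g (x i \<omega>) - v\<bar> \<partial>W) \<le> e"
  defines "q \<equiv> u * b i"
  shows "cmod ((\<integral>\<omega>. iexp (u * (x (Suc i) \<omega> - c)) \<partial>W) - exp (- (q\<^sup>2 * v / 2)) * (\<integral>\<omega>. iexp (u * (x i \<omega> - c)) \<partial>W))
    \<le> q\<^sup>2 / 2 * e + \<bar>q\<bar> ^ 3 / 6 * (1 + Q) + (q\<^sup>2 * v / 2)\<^sup>2 / 2"
proof -
  let ?e = "\<lambda>\<omega>. iexp (u * (x i \<omega> - c))"
  define y where "y = q\<^sup>2 * v / 2"
  have y: "0 \<le> y" using v by (simp add: y_def)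
  define R where "R \<omega> = iexp (q * z i \<omega>) - (1 + \<i> * (q * z i \<omega>) - complex_of_real ((q * z i \<omega>)\<^sup>2 / 2))" for \<omega>
  define r where "r = exp (- y) - (1 - y)"
  have q2: "0 \<le> q\<^sup>2 / 2" by simp
  have [measurable]: "R \<in> borel_measurable W" unfolding R_def by measurable
  have R: "cmod (R \<omega>) \<le> \<bar>q\<bar> ^ 3 / 6 * \<bar>z i \<omega>\<bar> ^ 3" for \<omega>
    using iexp_remainder[of "q * z i \<omega>"] by (simp add: R_def abs_mult power_mult_distrib)
  have iR: "integrable W (\<lambda>\<omega>. ?e \<omega> * R \<omega>)"
  proof (rule Bochner_Integration.integrable_bound)
    show "integrable W (\<lambda>\<omega>. \<bar>q\<bar> ^ 3 / 6 * \<bar>z i \<omega>\<bar> ^ 3)" using integrable_z3 by simp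
    show "AE \<omega> in W. norm (?e \<omega> * R \<omega>) \<le> norm (\<bar>q\<bar> ^ 3 / 6 * \<bar>z i \<omega>\<bar> ^ 3)"
      unfolding norm_mult norm_exp_i_times mult_1_left using order_trans[OF R abs_ge_self]
      by (intro AE_I2) (simp add: abs_mult)
  qed measurable
  have "cmod (\<integral>\<omega>. ?e \<omega> * R \<omega> \<partial>W) \<le> (\<integral>\<omega>. cmod (?e \<omega> * R \<omega>) \<partial>W)"
    by (rule integral_norm_bound)
  also have "\<dots> \<le> (\<integral>\<omega>. \<bar>q\<bar> ^ 3 / 6 * \<bar>z i \<omega>\<bar> ^ 3 \<partial>W)"
    using integrable_z3 integrable_norm[OF iR] R by (intro integral_mono) (auto simp: norm_mult)
  also have "\<dots> \<le> \<bar>q\<bar> ^ 3 / 6 * (1 + Q)" using z3_le[of i] by (simp add: mult_left_mono)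
  finally have bR: "cmod (\<integral>\<omega>. ?e \<omega> * R \<omega> \<partial>W) \<le> \<bar>q\<bar> ^ 3 / 6 * (1 + Q)" .
  have br: "cmod (complex_of_real r * (\<integral>\<omega>. ?e \<omega> \<partial>W)) \<le> y\<^sup>2 / 2"
  proof -
    have "cmod (\<integral>\<omega>. ?e \<omega> \<partial>W) \<le> (\<integral>\<omega>. cmod (?e \<omega>) \<partial>W)" by (rule integral_norm_bound)
    also have "\<dots> = 1" unfolding norm_exp_i_times by (simp add: prob_space)
    finally have "cmod (\<integral>\<omega>. ?e \<omega> \<partial>W) \<le> 1" .
    then have "\<bar>r\<bar> * cmod (\<integral>\<omega>. ?e \<omega> \<partial>W) \<le> \<bar>r\<bar> * 1" by (intro mult_left_mono) auto
    then have "cmod (complex_of_real r * (\<integral>\<omega>. ?e \<omega> \<partial>W)) \<le> \<bar>r\<bar>" unfolding norm_mult norm_of_real by simp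
    also have "\<dots> \<le> y\<^sup>2 / 2" using exp_remainder[OF y] by (simp add: r_def)
    finally show ?thesis .
  qed
  have split: "iexp (u * (x (Suc i) \<omega> - c)) - complex_of_real (exp (- y)) * ?e \<omega> =
      (\<i> * complex_of_real q) * (?e \<omega> * complex_of_real (z i \<omega>))
      - complex_of_real (q\<^sup>2 / 2) * (?e \<omega> * complex_of_real ((z i \<omega>)\<^sup>2 - v)) + ?e \<omega> * R \<omega> - complex_of_real r * ?e \<omega>" for \<omega>
  proof -
    have e1: "iexp (u * (x (Suc i) \<omega> - c)) = ?e \<omega> * iexp (q * z i \<omega>)"
      by (simp add: x_Suc q_def algebra_simps flip: exp_add)
    have e2: "iexp (q * z i \<omega>) = R \<omega> + (1 + \<i> * (q * z i \<omega>) - complex_of_real ((q * z i \<omega>)\<^sup>2 / 2))"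
      by (simp add: R_def)
    have e3: "exp (- y) = r + (1 - q\<^sup>2 * v / 2)" by (simp add: r_def y_def)
    \<comment> \<open>Stated for arbitrary \<open>E\<close>, \<open>R'\<close> and \<open>z'\<close>
      so that the algebra is polynomial and meets no exponentials.\<close>
    have ident: "E * (R' + (1 + \<i> * (q * z') - complex_of_real ((q * z')\<^sup>2 / 2))) - complex_of_real (r + (1 - q\<^sup>2 * v / 2)) * E =
      (\<i> * complex_of_real q) * (E * complex_of_real z')
      - complex_of_real (q\<^sup>2 / 2) * (E * complex_of_real (z'\<^sup>2 - v)) + E * R' - complex_of_real r * E" for E R' z'
      by (simp add: power2_eq_square field_simps)
    show ?thesis unfolding e1 unfolding e2 e3 by (rule ident)
  qed
  have "(\<integral>\<omega>. iexp (u * (x (Suc i) \<omega> - c)) \<partial>W) - complex_of_real (exp (- y)) * (\<integral>\<omega>. ?e \<omega> \<partial>W)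
      = (\<integral>\<omega>. iexp (u * (x (Suc i) \<omega> - c)) - complex_of_real (exp (- y)) * ?e \<omega> \<partial>W)"
    using integrable_iexp_x by (subst Bochner_Integration.integral_diff) auto
  also have "\<dots> = (\<i> * complex_of_real q) * (\<integral>\<omega>. ?e \<omega> * complex_of_real (z i \<omega>) \<partial>W)
      - complex_of_real (q\<^sup>2 / 2) * (\<integral>\<omega>. ?e \<omega> * complex_of_real ((z i \<omega>)\<^sup>2 - v) \<partial>W)
      + (\<integral>\<omega>. ?e \<omega> * R \<omega> \<partial>W) - complex_of_real r * (\<integral>\<omega>. ?e \<omega> \<partial>W)"
    unfolding split
    by (simp only: Bochner_Integration.integral_diff Bochner_Integration.integral_add integral_mult_right_zero
        Bochner_Integration.integrable_diff Bochner_Integration.integrable_add integrable_mult_right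
        integral_iexp_z(1) integral_iexp_z2(1) iR integrable_iexp_x)
  also have "\<dots> = - complex_of_real (q\<^sup>2 / 2) * (\<integral>\<omega>. ?e \<omega> * complex_of_real ((z i \<omega>)\<^sup>2 - v) \<partial>W)
      + (\<integral>\<omega>. ?e \<omega> * R \<omega> \<partial>W) - complex_of_real r * (\<integral>\<omega>. ?e \<omega> \<partial>W)"
    unfolding integral_iexp_z(2) by simp
  finally have eq: "(\<integral>\<omega>. iexp (u * (x (Suc i) \<omega> - c)) \<partial>W) - complex_of_real (exp (- y)) * (\<integral>\<omega>. ?e \<omega> \<partial>W) = \<dots>" .
  have "cmod (- complex_of_real (q\<^sup>2 / 2) * (\<integral>\<omega>. ?e \<omega> * complex_of_real ((z i \<omega>)\<^sup>2 - v) \<partial>W))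
      = q\<^sup>2 / 2 * cmod (\<integral>\<omega>. ?e \<omega> * complex_of_real ((z i \<omega>)\<^sup>2 - v) \<partial>W)"
    unfolding norm_mult norm_minus_cancel norm_of_real abs_of_nonneg[OF q2] ..
  also have "\<dots> \<le> q\<^sup>2 / 2 * e"
    by (intro mult_left_mono order_trans[OF integral_iexp_z2(2) e] q2)
  finally have bz: "cmod (- complex_of_real (q\<^sup>2 / 2) * (\<integral>\<omega>. ?e \<omega> * complex_of_real ((z i \<omega>)\<^sup>2 - v) \<partial>W)) \<le> q\<^sup>2 / 2 * e" .
  show ?thesis unfolding y_def[symmetric] eq
    by (rule order_trans[OF norm_triangle_ineq4 add_mono[OF order_trans[OF norm_triangle_ineq add_mono[OF bz bR]] br]])
qed

text \<open>Multiplying by the growing factor cancels the decay exp(-q^2 v / 2) of each step, so the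
  error of step N is merely added. Factoring q^2 out of the bound in \<open>char_step\<close> and
  using |q| <= \<alpha> gives the constant in parentheses; the squares then add up to
  \<open>A N\<close>, and \<open>S\<close> bounds the factor itself.\<close>

lemma char_bound:
  fixes u v e \<alpha> :: real
  assumes v: "0 \<le> v" and e: "\<And>i. (\<integral>\<omega>. \<bar>g (x i \<omega>) - v\<bar> \<partial>W) \<le> e"
    and a: "\<And>i. \<bar>u\<bar> * b i \<le> \<alpha>" and sum: "\<And>N. (\<Sum>i<N. (u * b i)\<^sup>2) \<le> S"
  defines "A \<equiv> \<lambda>N. (\<Sum>i<N. (u * b i)\<^sup>2)"
  shows "cmod (complex_of_real (exp (A N * v / 2)) * (\<integral>\<omega>. iexp (u * (x N \<omega> - c)) \<partial>W) - 1)
    \<le> exp (S * v / 2) * (e / 2 + \<alpha> / 6 * (1 + Q) + \<alpha>\<^sup>2 * v\<^sup>2 / 8) * A N"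
proof (induction N)
  case 0 then show ?case by (simp add: A_def x_0 prob_space)
next
  case (Suc N)
  define \<kappa> where "\<kappa> = e / 2 + \<alpha> / 6 * (1 + Q) + \<alpha>\<^sup>2 * v\<^sup>2 / 8"
  define q where "q = u * b N"
  let ?\<phi> = "\<lambda>N. \<integral>\<omega>. iexp (u * (x N \<omega> - c)) \<partial>W"
  have q: "\<bar>q\<bar> \<le> \<alpha>" using a[of N] b_pos[of N] by (simp add: q_def abs_mult)
  have AS: "A (Suc N) = A N + q\<^sup>2" by (simp add: A_def q_def)
  have "q\<^sup>2 / 2 * e + \<bar>q\<bar> ^ 3 / 6 * (1 + Q) + (q\<^sup>2 * v / 2)\<^sup>2 / 2
      = q\<^sup>2 * (e / 2 + \<bar>q\<bar> / 6 * (1 + Q) + \<bar>q\<bar>\<^sup>2 * v\<^sup>2 / 8)"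
    by (simp add: power2_eq_square power3_eq_cube field_simps abs_mult_self_eq)
  also have "\<dots> \<le> q\<^sup>2 * \<kappa>"
    unfolding \<kappa>_def using q Q_nonneg
    by (intro mult_left_mono add_mono mult_right_mono divide_right_mono power_mono) auto
  finally have step: "cmod (?\<phi> (Suc N) - exp (- (q\<^sup>2 * v / 2)) * ?\<phi> N) \<le> q\<^sup>2 * \<kappa>"
    using char_step[OF v e, of u N] unfolding q_def by linarith
  let ?w = "exp (A (Suc N) * v / 2)"
  have "?w * exp (- (q\<^sup>2 * v / 2)) = exp (A N * v / 2)"
    by (simp add: AS algebra_simps add_divide_distrib flip: exp_add)
  then have eq: "complex_of_real ?w * ?\<phi> (Suc N) - 1 = complex_of_real ?w * (?\<phi> (Suc N) - exp (- (q\<^sup>2 * v / 2)) * ?\<phi> N)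
       + (complex_of_real (exp (A N * v / 2)) * ?\<phi> N - 1)"
    by (simp add: algebra_simps flip: of_real_mult)
  have "?w \<le> exp (S * v / 2)" using sum[of "Suc N"] v by (simp add: A_def mult_right_mono)
  then have "cmod (complex_of_real ?w * (?\<phi> (Suc N) - exp (- (q\<^sup>2 * v / 2)) * ?\<phi> N)) \<le> exp (S * v / 2) * (q\<^sup>2 * \<kappa>)"
    unfolding norm_mult norm_of_real using step by (intro mult_mono) auto
  then have "cmod (complex_of_real ?w * ?\<phi> (Suc N) - 1) \<le> exp (S * v / 2) * (q\<^sup>2 * \<kappa>) + exp (S * v / 2) * \<kappa> * A N"
    unfolding eq using Suc unfolding \<kappa>_def by (intro order_trans[OF norm_triangle_ineq] add_mono) auto
  also have "\<dots> = exp (S * v / 2) * \<kappa> * A (Suc N)" by (simp add: AS algebra_simps)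
  finally show ?case by (simp add: \<kappa>_def)
qed

text \<open>The row length tends to infinity with \<open>n\<close> fixed: dominated convergence for
  the bounded exponentials on the left, convergence of \<open>A N\<close> to \<open>S\<close> on
  both sides.\<close>

lemma char_limit_bound:
  fixes u v e \<alpha> :: real
  assumes v: "0 \<le> v" and e: "\<And>i. (\<integral>\<omega>. \<bar>g (x i \<omega>) - v\<bar> \<partial>W) \<le> e"
    and a: "\<And>i. \<bar>u\<bar> * b i \<le> \<alpha>" and sum: "(\<lambda>i. (u * b i)\<^sup>2) sums S"
    and L[measurable]: "L \<in> borel_measurable W" and lim: "AE \<omega> in W. (\<lambda>i. x i \<omega>) \<longlonglongrightarrow> L \<omega>"
  shows "cmod (complex_of_real (exp (S * v / 2)) * (\<integral>\<omega>. iexp (u * (L \<omega> - c)) \<partial>W) - 1)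
    \<le> exp (S * v / 2) * (e / 2 + \<alpha> / 6 * (1 + Q) + \<alpha>\<^sup>2 * v\<^sup>2 / 8) * S"
proof (rule LIMSEQ_le)
  let ?A = "\<lambda>N. \<Sum>i<N. (u * b i)\<^sup>2"
  have A: "?A \<longlonglongrightarrow> S" using sum by (simp add: sums_def)
  have phi: "(\<lambda>N. \<integral>\<omega>. iexp (u * (x N \<omega> - c)) \<partial>W) \<longlonglongrightarrow> (\<integral>\<omega>. iexp (u * (L \<omega> - c)) \<partial>W)"
  proof (rule integral_dominated_convergence[where w="\<lambda>_. 1"])
    show "AE \<omega> in W. (\<lambda>N. iexp (u * (x N \<omega> - c))) \<longlonglongrightarrow> iexp (u * (L \<omega> - c))"
      using lim by eventually_elim (intro tendsto_intros)
  qed auto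
  show "(\<lambda>N. cmod (complex_of_real (exp (?A N * v / 2)) * (\<integral>\<omega>. iexp (u * (x N \<omega> - c)) \<partial>W) - 1))
     \<longlonglongrightarrow> cmod (complex_of_real (exp (S * v / 2)) * (\<integral>\<omega>. iexp (u * (L \<omega> - c)) \<partial>W) - 1)"
    by (intro tendsto_intros A phi) auto
  show "(\<lambda>N. exp (S * v / 2) * (e / 2 + \<alpha> / 6 * (1 + Q) + \<alpha>\<^sup>2 * v\<^sup>2 / 8) * ?A N)
     \<longlonglongrightarrow> exp (S * v / 2) * (e / 2 + \<alpha> / 6 * (1 + Q) + \<alpha>\<^sup>2 * v\<^sup>2 / 8) * S"
    by (intro tendsto_intros A)
  have "?A N \<le> S" for N using sum_le_suminf[of "\<lambda>i. (u * b i)\<^sup>2" "{..<N}"] sum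
    by (simp add: sums_iff)
  from char_bound[OF v e a this]
  show "\<exists>N. \<forall>n\<ge>N. cmod (complex_of_real (exp (?A n * v / 2)) * (\<integral>\<omega>. iexp (u * (x n \<omega> - c)) \<partial>W) - 1)
     \<le> exp (S * v / 2) * (e / 2 + \<alpha> / 6 * (1 + Q) + \<alpha>\<^sup>2 * v\<^sup>2 / 8) * ?A n" by blast
qed

end

section \<open>Arrays\<close>
lemma summable_rate: "summable (\<lambda>i. (inverse (real (n + Suc i)))\<^sup>2)"
proof -
  have "summable (\<lambda>i. inverse (real (i + Suc n) ^ 2))"
    using inverse_power_summable[of 2, where 'a=real] by (subst summable_iff_shift) simp
  moreover have "(\<lambda>i. inverse (real (i + Suc n) ^ 2)) = (\<lambda>i. (inverse (real (n + Suc i)))\<^sup>2)"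
    by (simp add: power_inverse add_ac)
  ultimately show ?thesis by simp
qed

text \<open>Links the unordered sum in \<open>rate\<close> to the ordered series of squared steps:
  absolute convergence, then reindexing of {n+1, ...} by i -> n + i + 1.\<close>

lemma rate_sums: "(\<lambda>i. (inverse (real (n + Suc i)))\<^sup>2) sums (rate n)\<^sup>2"
proof -
  let ?f = "\<lambda>i. (inverse (real (n + Suc i)))\<^sup>2" and ?h = "\<lambda>i. n + Suc i"
  have s: "?f sums (\<Sum>i. ?f i)" using summable_rate by (rule summable_sums)
  then have "(?f has_sum (\<Sum>i. ?f i)) UNIV"
    using summable_rate[of n] by (intro norm_summable_imp_has_sum) (simp_all add: power_inverse)
  then have "((\<lambda>i. inverse ((real i)\<^sup>2)) \<circ> ?h has_sum (\<Sum>i. ?f i)) UNIV"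
    by (simp add: o_def power_inverse)
  then have "((\<lambda>i. inverse ((real i)\<^sup>2)) has_sum (\<Sum>i. ?f i)) (range ?h)"
    by (subst has_sum_reindex) (auto simp: inj_on_def)
  moreover have "range ?h = {Suc n..}"
  proof (intro set_eqI iffI)
    fix k assume "k \<in> {Suc n..}" then show "k \<in> range ?h" by (intro image_eqI[of _ _ "k - Suc n"]) auto
  qed auto
  ultimately have "(\<Sum>\<^sub>\<infinity>i\<in>{Suc n..}. inverse ((real i)\<^sup>2)) = (\<Sum>i. ?f i)" by (simp add: infsumI)
  moreover have "0 \<le> (\<Sum>i. ?f i)" using summable_rate by (rule suminf_nonneg) simp
  ultimately show ?thesis using s by (simp add: rate_def)
qed

text \<open>Term-by-term comparison with the telescoping series of 1/m - 1/(m+1), m starting at n +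
  1.\<close>

lemma rate_sq_ge: "1 / (real n + 1) \<le> (rate n)\<^sup>2"
proof (rule sums_le)
  show "(\<lambda>i. (inverse (real (n + Suc i)))\<^sup>2) sums (rate n)\<^sup>2" by (rule rate_sums)
  have "(\<lambda>i. 1 / (real i + (real n + 1))) \<longlonglongrightarrow> 0"
    using LIMSEQ_ignore_initial_segment[OF lim_1_over_n[where 'a=real], of "n + 1"] by (simp add: add_ac)
  from telescope_sums'[OF this]
  show "(\<lambda>i. 1 / (real i + (real n + 1)) - 1 / (real (Suc i) + (real n + 1))) sums (1 / (real n + 1))"
    by simp
  show "1 / (real i + (real n + 1)) - 1 / (real (Suc i) + (real n + 1)) \<le> (inverse (real (n + Suc i)))\<^sup>2" for i
  proof -
    define m where "m = real i + (real n + 1)"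
    have m: "0 < m" by (simp add: m_def)
    have "1 / m - 1 / (m + 1) = 1 / (m * (m + 1))" using m by (simp add: field_simps)
    also have "\<dots> \<le> 1 / (m * m)" using m by (intro divide_left_mono mult_left_mono) auto
    also have "\<dots> = (inverse m)\<^sup>2" by (simp add: power2_eq_square field_simps)
    finally show ?thesis by (simp add: m_def add_ac)
  qed
qed

lemma rate_pos: "0 < rate n"
proof -
  have "0 \<le> rate n" by (simp add: rate_def infsum_nonneg)
  moreover have "rate n \<noteq> 0" using rate_sq_ge[of n] by (auto simp: divide_le_0_iff)
  ultimately show ?thesis by simp
qed

text \<open>Asymptotic negligibility, uniform along the row: this is what makes the cubic remainders
  vanish.\<close>

lemma step_over_rate_le: "inverse (real (n + Suc i)) / rate n \<le> 1 / sqrt (real n + 1)"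
proof -
  have "inverse (real (n + Suc i)) / rate n \<le> (1 / (real n + 1)) / (1 / sqrt (real n + 1))"
  proof (rule frac_le)
    show "inverse (real (n + Suc i)) \<le> 1 / (real n + 1)" by (simp add: field_simps)
    have "sqrt (1 / (real n + 1)) \<le> rate n" using rate_sq_ge[of n] rate_pos[of n] by (intro real_le_lsqrt) auto
    then show "1 / sqrt (real n + 1) \<le> rate n" by (simp add: real_sqrt_divide)
  qed auto
  also have "\<dots> = sqrt (real n + 1) / (sqrt (real n + 1) * sqrt (real n + 1))" by simp
  also have "\<dots> = 1 / sqrt (real n + 1)" by (simp del: real_sqrt_mult_self)
  finally show ?thesis .
qed

text \<open>Both facts are transported from the standard normal law by the scaling x -> \<sigma>
  x.\<close>

lemma
  assumes \<sigma>: "0 < \<sigma>"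
  shows real_distribution_normal: "real_distribution (density lborel (normal_density 0 \<sigma>))"
    and char_normal: "char (density lborel (normal_density 0 \<sigma>)) t = exp (- (\<sigma>\<^sup>2 * t\<^sup>2) / 2)"
proof -
  let ?N = "density lborel (normal_density 0 \<sigma>)"
  interpret S: prob_space std_normal_distribution by (rule prob_space_normal_density) simp
  have d: "distributed std_normal_distribution lborel (\<lambda>x. x) std_normal_density"
    by (simp add: distributed_def distr_id2)
  have "distributed std_normal_distribution lborel (\<lambda>x. \<sigma> * x) (normal_density 0 \<sigma>)"
    using d \<sigma> by (subst S.normal_standard_normal_convert[OF \<sigma>]) simp
  then have "?N = distr std_normal_distribution lborel (\<lambda>x. \<sigma> * x)"
    by (simp add: distributed_def)
  also have "\<dots> = distr std_normal_distribution borel (\<lambda>x. \<sigma> * x)" by (intro distr_cong) auto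
  finally have eq: "?N = distr std_normal_distribution borel (\<lambda>x. \<sigma> * x)" .
  show "real_distribution ?N"
    unfolding real_distribution_def real_distribution_axioms_def
    using prob_space_normal_density[OF \<sigma>, of 0] by simp
  have "char ?N t = char std_normal_distribution (t * \<sigma>)"
    unfolding eq char_def by (subst integral_distr) (auto simp: mult.assoc)
  then show "char ?N t = exp (- (\<sigma>\<^sup>2 * t\<^sup>2) / 2)"
    by (simp add: char_std_normal_distribution power_mult_distrib mult.commute)
qed

lemma moment_bound_mono:
  assumes "\<bar>c\<bar> \<le> K" "0 \<le> C" shows "moment_bound B C c \<le> moment_bound B C K"
proof -
  have "\<bar>c\<bar> ^ 4 \<le> K ^ 4" using assms by (intro power_mono) auto
  then show ?thesis using assms unfolding moment_bound_def by (auto intro!: mult_left_mono)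
qed

text \<open>Each row has its own probability space; rows share only \<open>g\<close>,
  \<open>T\<close>, \<open>B\<close>, \<open>C\<close> and converging starting points. Row
  \<open>n\<close> takes steps 1/(n + i + 1), so rows are indexed from 1.\<close>

locale adapted_recursion_array =
  fixes W :: "nat \<Rightarrow> 'w measure" and F :: "nat \<Rightarrow> nat \<Rightarrow> 'w measure" and x z :: "nat \<Rightarrow> nat \<Rightarrow> 'w \<Rightarrow> real"
    and g :: "real \<Rightarrow> real" and T :: "real set" and B C s :: real and c :: "nat \<Rightarrow> real"
  assumes row: "1 \<le> n \<Longrightarrow> adapted_recursion (W n) (F n) (x n) (z n) g T B C (c n) n"
    and c: "c \<longlonglongrightarrow> s" and s: "s \<in> T" and cont: "continuous (at s within T) g" and pos: "0 < g s"
begin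

lemma BC: "0 \<le> B" "0 \<le> C"
  using row[of 1] by (auto simp: adapted_recursion_def adapted_recursion_axioms_def)

text \<open>Order of choice: \<open>K\<close> bounds all starting points and fixes one
  \<open>Q\<close>; continuity gives \<delta>; \<eta> is made small; only then is \<open>n\<close>
  taken large. The bound of \<open>integral_g_diff_le\<close> does not mention \<open>i\<close>,
  hence the uniformity along the row.\<close>

lemma g_mean_convergence:
  assumes "0 < \<epsilon>"
  shows "\<forall>\<^sub>F n in sequentially. \<forall>i. (\<integral>\<omega>. \<bar>g (x n i \<omega>) - g s\<bar> \<partial>W n) \<le> \<epsilon>"
proof -
  obtain K where K: "\<And>n. \<bar>c n\<bar> \<le> K"
    using convergent_imp_Bseq[of c] c by (auto simp: convergent_def Bseq_def)
  define Q where "Q = moment_bound B C K"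
  have Q0: "0 \<le> Q" using BC by (simp add: Q_def moment_bound_def)
  obtain \<delta> where \<delta>: "0 < \<delta>" "\<And>t. t \<in> T \<Longrightarrow> \<bar>t - s\<bar> < \<delta> \<Longrightarrow> \<bar>g t - g s\<bar> < \<epsilon> / 3"
    using cont assms unfolding continuous_within_eps_delta dist_real_def by (meson divide_pos_pos zero_less_numeral)
  \<comment> \<open>Chosen so that the term 2 \<eta> (Q + (g s)^2) of
    \<open>integral_g_diff_le\<close> equals \<epsilon>/3.\<close>
  define \<eta> where "\<eta> = \<epsilon> / (6 * (Q + (g s)\<^sup>2))"
  have Qg: "0 < Q + (g s)\<^sup>2" using Q0 pos by (simp add: add_nonneg_pos)
  then have \<eta>: "0 < \<eta>" using assms by (simp add: \<eta>_def)
  have \<eta>2: "2 * \<eta> * (Q + (g s)\<^sup>2) = \<epsilon> / 3"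
  proof -
    have "2 * (\<epsilon> / (6 * k)) * k = \<epsilon> / 3" if "0 < k" for k using that by simp
    from this[OF Qg] show ?thesis by (simp only: \<eta>_def)
  qed
  have "(\<lambda>n. (2 * (1 + Q) * (1 / real n) + 2 * (c n - s)\<^sup>2) / (\<eta> * \<delta>\<^sup>2)) \<longlonglongrightarrow> (2 * (1 + Q) * 0 + 2 * (s - s)\<^sup>2) / (\<eta> * \<delta>\<^sup>2)"
    using \<eta> \<delta> by (intro tendsto_intros c lim_1_over_n) auto
  then have "\<forall>\<^sub>F n in sequentially. (2 * (1 + Q) * (1 / real n) + 2 * (c n - s)\<^sup>2) / (\<eta> * \<delta>\<^sup>2) < \<epsilon> / 3"
    using assms by (intro order_tendstoD) auto
  then show ?thesis using eventually_ge_at_top[of 1]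
  proof eventually_elim
    case (elim n)
    interpret adapted_recursion "W n" "F n" "x n" "z n" g T B C "c n" n using elim by (intro row) simp
    have QQ: "moment_bound B C (c n) \<le> Q" unfolding Q_def using K BC by (intro moment_bound_mono)
    show ?case
    proof
      fix i
      have "(\<integral>\<omega>. \<bar>g (x n i \<omega>) - g s\<bar> \<partial>W n) \<le> \<epsilon> / 3 + 2 * \<eta> * (moment_bound B C (c n) + (g s)\<^sup>2)
          + (2 * (1 + moment_bound B C (c n)) / real n + 2 * (c n - s)\<^sup>2) / (\<eta> * \<delta>\<^sup>2)"
        using \<delta> \<eta> assms by (intro integral_g_diff_le) (auto intro: less_imp_le)
      also have "\<dots> \<le> \<epsilon> / 3 + 2 * \<eta> * (Q + (g s)\<^sup>2) + (2 * (1 + Q) / real n + 2 * (c n - s)\<^sup>2) / (\<eta> * \<delta>\<^sup>2)"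
        using QQ \<eta> \<delta> by (intro add_mono mult_left_mono divide_right_mono) auto
      also have "\<dots> \<le> \<epsilon> / 3 + \<epsilon> / 3 + \<epsilon> / 3" using elim(1)
        unfolding \<eta>2 times_divide_eq_right mult_1_right by (intro add_mono order_refl less_imp_le)
      finally show "(\<integral>\<omega>. \<bar>g (x n i \<omega>) - g s\<bar> \<partial>W n) \<le> \<epsilon>" by simp
    qed
  qed
qed

context
  fixes L :: "nat \<Rightarrow> 'w \<Rightarrow> real"
  assumes L [measurable]: "\<And>n. 1 \<le> n \<Longrightarrow> L n \<in> borel_measurable (W n)"
    and lim: "\<And>n. 1 \<le> n \<Longrightarrow> AE \<omega> in W n. (\<lambda>i. x n i \<omega>) \<longlonglongrightarrow> L n \<omega>"
begin

text \<open>\<open>char_limit_bound\<close> at frequency u / \<open>rate n\<close>, for which the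
  squared normalised steps sum to exactly u^2. The compensating factor is thus the same
  \<open>w\<close> for every row and can be divided out at the end.\<close>

lemma char_convergence:
  "(\<lambda>n. \<integral>\<omega>. iexp (u * (inverse (rate n) * (L n \<omega> - c n))) \<partial>W n) \<longlonglongrightarrow> complex_of_real (exp (- (g s * u\<^sup>2) / 2))"
proof -
  let ?\<phi> = "\<lambda>n. \<integral>\<omega>. iexp (u * (inverse (rate n) * (L n \<omega> - c n))) \<partial>W n"
  define w where "w = exp (u\<^sup>2 * g s / 2)"
  obtain K where K: "\<And>n. \<bar>c n\<bar> \<le> K"
    using convergent_imp_Bseq[of c] c by (auto simp: convergent_def Bseq_def)
  define Q where "Q = moment_bound B C K"
  have Q0: "0 \<le> Q" using BC by (simp add: Q_def moment_bound_def)
  define \<alpha> where "\<alpha> n = \<bar>u\<bar> * (1 / sqrt (real n + 1))" for n :: nat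
  define \<kappa> where "\<kappa> = w * u\<^sup>2"
  have \<kappa>: "0 \<le> \<kappa>" by (simp add: \<kappa>_def w_def)
  have "(\<lambda>n. complex_of_real w * ?\<phi> n) \<longlonglongrightarrow> 1"
  proof (rule tendstoI)
    fix r :: real assume r: "0 < r"
    \<comment> \<open>The added 1 covers u = 0, where \<kappa> vanishes; in every case \<kappa> e /
      2 is at most r / 2.\<close>
    define e where "e = r / (\<kappa> + 1)"
    have e: "0 < e" using r \<kappa> by (simp add: e_def)
    have \<kappa>e: "\<kappa> * e \<le> r" using r \<kappa> by (simp add: e_def field_simps)
    have "(\<lambda>n. sqrt (inverse (real (Suc n)))) \<longlonglongrightarrow> sqrt 0"
      by (intro tendsto_intros LIMSEQ_inverse_real_of_nat)
    then have "(\<lambda>n. 1 / sqrt (real n + 1)) \<longlonglongrightarrow> 0"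
      by (simp add: real_sqrt_divide inverse_eq_divide add.commute)
    then have "(\<lambda>n. \<kappa> * (\<alpha> n / 6 * (1 + Q) + (\<alpha> n)\<^sup>2 * (g s)\<^sup>2 / 8)) \<longlonglongrightarrow> \<kappa> * (\<bar>u\<bar> * 0 / 6 * (1 + Q) + (\<bar>u\<bar> * 0)\<^sup>2 * (g s)\<^sup>2 / 8)"
      unfolding \<alpha>_def by (intro tendsto_intros) auto
    then have "\<forall>\<^sub>F n in sequentially. \<kappa> * (\<alpha> n / 6 * (1 + Q) + (\<alpha> n)\<^sup>2 * (g s)\<^sup>2 / 8) < r / 2"
      using r by (intro order_tendstoD) auto
    then show "\<forall>\<^sub>F n in sequentially. dist (complex_of_real w * ?\<phi> n) 1 < r"
      using g_mean_convergence[OF e] eventually_ge_at_top[of 1]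
    proof eventually_elim
      case (elim n)
      interpret adapted_recursion "W n" "F n" "x n" "z n" g T B C "c n" n using elim by (intro row) simp
      have QQ: "moment_bound B C (c n) \<le> Q" unfolding Q_def using K BC by (intro moment_bound_mono)
      have arg: "u / rate n * y = u * (inverse (rate n) * y)" for y by (simp add: divide_inverse)
      have "cmod (complex_of_real (exp (u\<^sup>2 * g s / 2)) * (\<integral>\<omega>. iexp ((u / rate n) * (L n \<omega> - c n)) \<partial>W n) - 1)
        \<le> exp (u\<^sup>2 * g s / 2) * (e / 2 + \<alpha> n / 6 * (1 + moment_bound B C (c n)) + (\<alpha> n)\<^sup>2 * (g s)\<^sup>2 / 8) * u\<^sup>2"
      proof (rule char_limit_bound)
        show "\<bar>u / rate n\<bar> * b i \<le> \<alpha> n" for i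
        proof -
          have "\<bar>u\<bar> * (b i / rate n) \<le> \<alpha> n"
            unfolding \<alpha>_def b_def by (intro mult_left_mono step_over_rate_le) simp
          then show ?thesis using rate_pos[of n] by (simp add: abs_divide)
        qed
        have "(\<lambda>i. (u / rate n)\<^sup>2 * (b i)\<^sup>2) sums ((u / rate n)\<^sup>2 * (rate n)\<^sup>2)"
          unfolding b_def by (intro sums_mult rate_sums)
        then show "(\<lambda>i. (u / rate n * b i)\<^sup>2) sums u\<^sup>2"
          using rate_pos[of n] by (simp add: power_mult_distrib power_divide)
      qed (use elim pos L lim in \<open>auto simp: less_imp_le\<close>)
      also have "\<dots> \<le> exp (u\<^sup>2 * g s / 2) * (e / 2 + \<alpha> n / 6 * (1 + Q) + (\<alpha> n)\<^sup>2 * (g s)\<^sup>2 / 8) * u\<^sup>2"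
        using QQ by (intro mult_right_mono mult_left_mono add_mono) (auto simp: \<alpha>_def)
      also have "\<dots> = \<kappa> * e / 2 + \<kappa> * (\<alpha> n / 6 * (1 + Q) + (\<alpha> n)\<^sup>2 * (g s)\<^sup>2 / 8)"
        unfolding \<kappa>_def w_def by (simp add: algebra_simps)
      also have "\<dots> < r" using \<kappa>e elim(1) by linarith
      finally show ?case unfolding arg w_def[symmetric] dist_norm .
    qed
  qed
  then have lim_w: "(\<lambda>n. complex_of_real (inverse w) * (complex_of_real w * ?\<phi> n)) \<longlonglongrightarrow> complex_of_real (inverse w) * 1"
    by (intro tendsto_intros)
  have cancel: "complex_of_real (inverse w) * (complex_of_real w * y) = y" for y
  proof -
    have "inverse w * w = 1" by (simp add: w_def)
    then show ?thesis unfolding mult.assoc[symmetric] of_real_mult[symmetric] by simp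
  qed
  have inv: "inverse w = exp (- (g s * u\<^sup>2) / 2)" by (simp add: w_def exp_minus mult.commute)
  show ?thesis using lim_w unfolding cancel mult_1_right unfolding inv .
qed

theorem weak_convergence:
  "weak_conv_m (\<lambda>n. distr (W n) borel (\<lambda>\<omega>. inverse (rate n) * (L n \<omega> - c n)))
     (density lborel (normal_density 0 (sqrt (g s))))"
proof -
  let ?D = "\<lambda>n. distr (W n) borel (\<lambda>\<omega>. inverse (rate n) * (L n \<omega> - c n))"
  let ?N = "density lborel (normal_density 0 (sqrt (g s)))"
  have meas: "(\<lambda>\<omega>. inverse (rate n) * (L n \<omega> - c n)) \<in> borel_measurable (W n)" if "1 \<le> n" for n
    using L[OF that] by measurable
  \<comment> \<open>Row 0 satisfies no hypothesis, so its image measure need not be a probability;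
    Levy's theorem is applied to the shifted sequence, and the shift is undone afterwards.\<close>
  have "weak_conv_m (\<lambda>n. ?D (Suc n)) ?N"
  proof (rule levy_continuity)
    fix n
    interpret adapted_recursion "W (Suc n)" "F (Suc n)" "x (Suc n)" "z (Suc n)" g T B C "c (Suc n)" "Suc n"
      by (intro row) simp
    show "real_distribution (?D (Suc n))" using meas by (intro real_distribution_distr) simp
  next
    show "real_distribution ?N" using pos by (intro real_distribution_normal) simp
  next
    fix u
    have "char (?D n) u = (\<integral>\<omega>. iexp (u * (inverse (rate n) * (L n \<omega> - c n))) \<partial>W n)" if "1 \<le> n" for n
      unfolding char_def using meas[OF that] by (subst integral_distr) auto
    then have "(\<lambda>n. char (?D (Suc n)) u) = (\<lambda>n. \<integral>\<omega>. iexp (u * (inverse (rate (Suc n)) * (L (Suc n) \<omega> - c (Suc n)))) \<partial>W (Suc n))"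
      by simp
    moreover have "char ?N u = complex_of_real (exp (- (g s * u\<^sup>2) / 2))"
      using pos char_normal[of "sqrt (g s)" u] by simp
    ultimately show "(\<lambda>n. char (?D (Suc n)) u) \<longlonglongrightarrow> char ?N u"
      using LIMSEQ_Suc[OF char_convergence[of u]] by simp
  qed
  then show ?thesis unfolding weak_conv_m_def weak_conv_def by (auto intro: LIMSEQ_imp_Suc)
qed

end

end

section \<open>Predictive resampling\<close>
text \<open>The score is jointly measurable over \<Theta> only, whereas iterates are real-valued and
  lie in \<Theta> merely almost surely. As \<Theta> is Borel and the score is 0 off it by
  convention, it is measurable over all parameters.\<close>

lemma borel_measurable_extend_zero:
  fixes f :: "real \<Rightarrow> 'y \<Rightarrow> real"
  assumes S: "S \<in> sets borel" and f: "(\<lambda>(t, y). f t y) \<in> borel_measurable (restrict_space borel S \<Otimes>\<^sub>M M)"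
    and zero: "\<And>t y. t \<notin> S \<Longrightarrow> f t y = 0"
  shows "(\<lambda>(t, y). f t y) \<in> borel_measurable (borel \<Otimes>\<^sub>M M)"
proof -
  let ?R = "restrict_space (borel \<Otimes>\<^sub>M M) (S \<times> UNIV)"
  have sp: "(S \<times> UNIV) \<inter> space (borel \<Otimes>\<^sub>M M) = S \<times> space M" by (auto simp: space_pair_measure)
  have "S \<times> space M \<in> sets (borel \<Otimes>\<^sub>M M)" using S by (intro pair_measureI) auto
  moreover have "(\<lambda>(t, y). f t y) \<in> borel_measurable ?R"
  proof -
    have 1: "fst \<in> ?R \<rightarrow>\<^sub>M restrict_space borel S"
      by (intro measurable_restrict_space2 measurable_restrict_space1 measurable_fst) (auto simp: space_restrict_space)
    have 2: "snd \<in> ?R \<rightarrow>\<^sub>M M"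
      by (intro measurable_restrict_space1 measurable_snd)
    show ?thesis using measurable_compose[OF measurable_Pair[OF 1 2] f] by simp
  qed
  ultimately have "(\<lambda>p. if p \<in> S \<times> UNIV then (\<lambda>(t, y). f t y) p else 0) \<in> borel_measurable (borel \<Otimes>\<^sub>M M)"
    using sp by (subst measurable_restrict_space_iff[symmetric]) auto
  also have "(\<lambda>p. if p \<in> S \<times> UNIV then (\<lambda>(t, y). f t y) p else 0) = (\<lambda>(t, y). f t y)"
    using zero by (auto simp: fun_eq_iff)
  finally show ?thesis .
qed

lemma draws_algebra_subalgebra:
  assumes "\<And>j. 1 \<le> j \<Longrightarrow> Y j \<in> W \<rightarrow>\<^sub>M M"
  shows "subalgebra W (draws_algebra W M Y i)"
    and "1 \<le> j \<Longrightarrow> j \<le> i \<Longrightarrow> Y j \<in> draws_algebra W M Y i \<rightarrow>\<^sub>M M"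
proof -
  let ?G = "\<Union>j\<in>{1..i}. {Y j -` A \<inter> space W | A. A \<in> sets M}"
  have G: "?G \<subseteq> Pow (space W)" by auto
  have sets: "sets (draws_algebra W M Y i) = sigma_sets (space W) ?G"
    unfolding draws_algebra_def using G by (rule sets_measure_of)
  have space: "space (draws_algebra W M Y i) = space W"
    by (simp add: draws_algebra_def space_measure_of_conv)
  have "?G \<subseteq> sets W" using assms by (auto intro: measurable_sets)
  then have "sigma_sets (space W) ?G \<subseteq> sets W" by (rule sets.sigma_sets_subset)
  then show "subalgebra W (draws_algebra W M Y i)" by (simp add: subalgebra_def sets space)
  assume j: "1 \<le> j" "j \<le> i"
  show "Y j \<in> draws_algebra W M Y i \<rightarrow>\<^sub>M M"
  proof (rule measurableI)
    fix \<omega> assume "\<omega> \<in> space (draws_algebra W M Y i)"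
    then show "Y j \<omega> \<in> space M" using assms[OF j(1)] by (auto simp: space dest: measurable_space)
  next
    fix A assume "A \<in> sets M"
    then have "Y j -` A \<inter> space W \<in> ?G" using j by (intro UN_I[of j] CollectI exI[of _ A]) auto
    then show "Y j -` A \<inter> space (draws_algebra W M Y i) \<in> sets (draws_algebra W M Y i)"
      unfolding sets space by (rule sigma_sets.Basic)
  qed
qed

lemma score_outside: "t \<notin> \<Theta> \<Longrightarrow> score \<Theta> p t y = 0"
  by (simp add: score_def has_score_def)

text \<open>The second moment of Z is I^(-2) I = I^(-1). Non-negativity of the variance of Z^2 then
  bounds I^(-2) by the fourth moment, which becomes \<open>g_le\<close>.\<close>

lemma scaled_score_moments:
  assumes t: "t \<in> \<Theta>" and P: "prob_space (model M p t)"
    and sc: "integrable (model M p t) (score \<Theta> p t)" "(\<integral>y. score \<Theta> p t y \<partial>model M p t) = 0"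
    and sq: "integrable (model M p t) (\<lambda>y. (score \<Theta> p t y)\<^sup>2)" and pos: "fisher M \<Theta> p t > 0"
    and four: "integrable (model M p t) (\<lambda>y. (scaled_score M \<Theta> p t y) ^ 4)"
  shows "integrable (model M p t) (scaled_score M \<Theta> p t)"
    and "(\<integral>y. scaled_score M \<Theta> p t y \<partial>model M p t) = 0"
    and "integrable (model M p t) (\<lambda>y. (scaled_score M \<Theta> p t y)\<^sup>2)"
    and "(\<integral>y. (scaled_score M \<Theta> p t y)\<^sup>2 \<partial>model M p t) = inverse (fisher M \<Theta> p t)"
    and "(inverse (fisher M \<Theta> p t))\<^sup>2 \<le> (\<integral>y. (scaled_score M \<Theta> p t y) ^ 4 \<partial>model M p t)"
proof -
  interpret prob_space "model M p t" by (rule P)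
  let ?Z = "scaled_score M \<Theta> p t"
  show "integrable (model M p t) ?Z" "(\<integral>y. ?Z y \<partial>model M p t) = 0"
    using sc unfolding scaled_score_def by auto
  show i2: "integrable (model M p t) (\<lambda>y. (?Z y)\<^sup>2)"
    using sq unfolding scaled_score_def power_mult_distrib by auto
  have "(\<integral>y. (?Z y)\<^sup>2 \<partial>model M p t) = (inverse (fisher M \<Theta> p t))\<^sup>2 * fisher M \<Theta> p t"
    unfolding scaled_score_def power_mult_distrib by (simp add: fisher_def)
  then show e: "(\<integral>y. (?Z y)\<^sup>2 \<partial>model M p t) = inverse (fisher M \<Theta> p t)"
    using pos by (simp add: power2_eq_square)
  have "0 \<le> variance (\<lambda>y. (?Z y)\<^sup>2)" by (rule variance_positive)
  also have "variance (\<lambda>y. (?Z y)\<^sup>2) = (\<integral>y. ((?Z y)\<^sup>2)\<^sup>2 \<partial>model M p t) - (\<integral>y. (?Z y)\<^sup>2 \<partial>model M p t)\<^sup>2"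
    using i2 four by (intro variance_eq) auto
  finally show "(inverse (fisher M \<Theta> p t))\<^sup>2 \<le> (\<integral>y. ?Z y ^ 4 \<partial>model M p t)"
    unfolding e by simp
qed

text \<open>Translation into the abstract row: \<open>z i\<close> is the scaled score at iterate
  \<open>i\<close> of draw \<open>Suc i\<close>, conditioned on the first \<open>i\<close> draws,
  and \<open>g\<close> is the inverse Fisher information. The kernel is the model at the current
  iterate.\<close>

lemma predictive_resampling_adapted_recursion:
  fixes M :: "'y measure" and W :: "'w measure"
  assumes \<Theta>: "\<Theta> \<in> sets borel"
    and score: "(\<lambda>(t, y). score \<Theta> p t y) \<in> borel_measurable (restrict_space borel \<Theta> \<Otimes>\<^sub>M M)"
    and P: "\<And>t. t \<in> \<Theta> \<Longrightarrow> prob_space (model M p t)"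
    and sc: "\<And>t. t \<in> \<Theta> \<Longrightarrow> integrable (model M p t) (score \<Theta> p t)"
      "\<And>t. t \<in> \<Theta> \<Longrightarrow> (\<integral>y. score \<Theta> p t y \<partial>model M p t) = 0"
    and sq: "\<And>t. t \<in> \<Theta> \<Longrightarrow> integrable (model M p t) (\<lambda>y. (score \<Theta> p t y)\<^sup>2)"
    and cont: "\<And>t. t \<in> \<Theta> \<Longrightarrow> continuous (at t within \<Theta>) (fisher M \<Theta> p)"
    and pos: "\<And>t. t \<in> \<Theta> \<Longrightarrow> fisher M \<Theta> p t > 0"
    and BC: "B \<ge> 0" "C \<ge> 0"
    and four: "\<And>t. t \<in> \<Theta> \<Longrightarrow> integrable (model M p t) (\<lambda>y. (scaled_score M \<Theta> p t y) ^ 4)"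
      "\<And>t. t \<in> \<Theta> \<Longrightarrow> (\<integral>y. (scaled_score M \<Theta> p t y) ^ 4 \<partial>model M p t) \<le> B + C * t ^ 4"
    and n: "n \<ge> 1" and pr: "predictive_resampling M \<Theta> p n c W Y"
  shows "adapted_recursion W (draws_algebra W M Y) (\<lambda>i \<omega>. iterate M \<Theta> p n c (\<lambda>j. Y j \<omega>) i)
     (\<lambda>i \<omega>. scaled_score M \<Theta> p (iterate M \<Theta> p n c (\<lambda>j. Y j \<omega>) i) (Y (Suc i) \<omega>))
     (\<lambda>t. inverse (fisher M \<Theta> p t)) \<Theta> B C c n"
proof -
  define F where "F = draws_algebra W M Y"
  define x where "x i \<omega> = iterate M \<Theta> p n c (\<lambda>j. Y j \<omega>) i" for i \<omega>
  let ?Z = "\<lambda>(t, y). scaled_score M \<Theta> p t y"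
  have W: "prob_space W" and Y: "\<And>j. 1 \<le> j \<Longrightarrow> Y j \<in> W \<rightarrow>\<^sub>M M"
    and xT': "AE \<omega> in W. \<forall>i. x i \<omega> \<in> \<Theta>"
    and cond: "\<And>i A. A \<in> sets M \<Longrightarrow> AE \<omega> in W. real_cond_exp W (F i) (\<lambda>\<omega>'. indicator A (Y (Suc i) \<omega>')) \<omega> =
        measure (model M p (x i \<omega>)) A"
    using pr unfolding predictive_resampling_def F_def x_def by auto
  have sub: "subalgebra W (F i)" for i unfolding F_def by (rule draws_algebra_subalgebra[OF Y])
  have YF: "1 \<le> j \<Longrightarrow> j \<le> i \<Longrightarrow> Y j \<in> F i \<rightarrow>\<^sub>M M" for i j
    unfolding F_def by (rule draws_algebra_subalgebra[OF Y])
  have xT: "AE \<omega> in W. x i \<omega> \<in> \<Theta>" for i using xT' by eventually_elim auto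
  have "fisher M \<Theta> p \<in> borel_measurable (restrict_space borel \<Theta>)"
    using cont by (intro borel_measurable_continuous_on_restrict) (simp add: continuous_on_eq_continuous_within)
  then have "(\<lambda>t. if t \<in> \<Theta> then fisher M \<Theta> p t else 0) \<in> borel_measurable borel"
    using \<Theta> by (subst measurable_restrict_space_iff[symmetric]) auto
  \<comment> \<open>Off \<Theta> the score is identically 0, hence so is the integral defining the
    information.\<close>
  also have "(\<lambda>t. if t \<in> \<Theta> then fisher M \<Theta> p t else 0) = fisher M \<Theta> p"
    by (auto simp: fun_eq_iff fisher_def score_outside)
  finally have fisher[measurable]: "fisher M \<Theta> p \<in> borel_measurable borel" .
  have "(\<lambda>(t, y). score \<Theta> p t y) \<in> borel_measurable (borel \<Otimes>\<^sub>M M)"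
    by (rule borel_measurable_extend_zero[OF \<Theta> score score_outside])
  moreover have "(\<lambda>q. inverse (fisher M \<Theta> p (fst q))) \<in> borel_measurable (borel \<Otimes>\<^sub>M M)"
    by measurable
  ultimately have "(\<lambda>q. inverse (fisher M \<Theta> p (fst q)) * (case q of (t, y) \<Rightarrow> score \<Theta> p t y)) \<in> borel_measurable (borel \<Otimes>\<^sub>M M)"
    by (rule borel_measurable_times[rotated])
  also have "(\<lambda>q. inverse (fisher M \<Theta> p (fst q)) * (case q of (t, y) \<Rightarrow> score \<Theta> p t y)) = ?Z"
    by (auto simp: fun_eq_iff scaled_score_def)
  finally have Z: "?Z \<in> borel_measurable (borel \<Otimes>\<^sub>M M)" .
  have x_F: "x k \<in> borel_measurable (F i)" if "k \<le> i" for k i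
    using that
  proof (induction k)
    case 0 then show ?case by (simp add: x_def[abs_def])
  next
    case (Suc k)
    then have xk[measurable]: "x k \<in> borel_measurable (F i)" by simp
    have "(\<lambda>\<omega>. ?Z (x k \<omega>, Y (Suc k) \<omega>)) \<in> borel_measurable (F i)"
      using Suc.prems by (intro measurable_compose[OF measurable_Pair Z] xk YF) auto
    then have "(\<lambda>\<omega>. x k \<omega> + inverse (real (n + Suc k)) * ?Z (x k \<omega>, Y (Suc k) \<omega>)) \<in> borel_measurable (F i)"
      by measurable
    then show ?case by (simp add: x_def[abs_def])
  qed
  note mom = scaled_score_moments[OF _ P sc sq pos four(1)]
  have ker: "AE \<omega> in W. real_cond_exp W (F i) (\<lambda>\<omega>. f (x i \<omega>, Y (Suc i) \<omega>)) \<omega> = (\<integral>y. f (x i \<omega>, y) \<partial>model M p (x i \<omega>))"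
    if "f \<in> borel_measurable (borel \<Otimes>\<^sub>M M)" "\<And>t. t \<in> \<Theta> \<Longrightarrow> integrable (model M p t) (\<lambda>y. f (t, y))"
    for f :: "_ \<Rightarrow> real" and i
    by (rule real_cond_exp_kernel[where T=\<Theta>, OF W sub x_F Y _ xT P cond that]) (auto simp: model_def)
  have "adapted_recursion W F x (\<lambda>i \<omega>. ?Z (x i \<omega>, Y (Suc i) \<omega>)) (\<lambda>t. inverse (fisher M \<Theta> p t)) \<Theta> B C c n"
  proof (intro adapted_recursion.intro adapted_recursion_axioms.intro)
    show "prob_space W" "\<And>i. subalgebra W (F i)" "0 \<le> B" "0 \<le> C" "1 \<le> n" "\<And>i. AE \<omega> in W. x i \<omega> \<in> \<Theta>"
      "\<And>k i. k \<le> i \<Longrightarrow> x k \<in> borel_measurable (F i)" "\<And>\<omega>. x 0 \<omega> = c"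
      using W sub BC n xT x_F by (auto simp: x_def)
    show "x (Suc i) \<omega> = x i \<omega> + inverse (real (n + Suc i)) * ?Z (x i \<omega>, Y (Suc i) \<omega>)" for i \<omega>
      by (simp add: x_def)
    show "(\<lambda>t. inverse (fisher M \<Theta> p t)) \<in> borel_measurable borel" by measurable
    show "(\<lambda>\<omega>. ?Z (x i \<omega>, Y (Suc i) \<omega>)) \<in> borel_measurable W" for i
      using measurable_from_subalg[OF sub x_F[of i i]]
      by (intro measurable_compose[OF measurable_Pair Z] Y) auto
    show "(inverse (fisher M \<Theta> p t))\<^sup>2 \<le> B + C * t ^ 4" if "t \<in> \<Theta>" for t
      using mom(5)[of t] four(2)[of t] that by force
    show "AE \<omega> in W. real_cond_exp W (F i) (\<lambda>\<omega>. ?Z (x i \<omega>, Y (Suc i) \<omega>)) \<omega> = 0" for i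
    proof -
      have "AE \<omega> in W. real_cond_exp W (F i) (\<lambda>\<omega>. ?Z (x i \<omega>, Y (Suc i) \<omega>)) \<omega> = (\<integral>y. ?Z (x i \<omega>, y) \<partial>model M p (x i \<omega>))"
        using mom(1) Z by (intro ker) auto
      then show ?thesis using xT[of i] by eventually_elim (simp add: mom(2))
    qed
    show "AE \<omega> in W. real_cond_exp W (F i) (\<lambda>\<omega>. (?Z (x i \<omega>, Y (Suc i) \<omega>))\<^sup>2) \<omega> = inverse (fisher M \<Theta> p (x i \<omega>))" for i
    proof -
      have "AE \<omega> in W. real_cond_exp W (F i) (\<lambda>\<omega>. (?Z (x i \<omega>, Y (Suc i) \<omega>))\<^sup>2) \<omega> = (\<integral>y. (?Z (x i \<omega>, y))\<^sup>2 \<partial>model M p (x i \<omega>))"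
        using mom(3) Z by (intro ker[of "\<lambda>q. (?Z q)\<^sup>2"] borel_measurable_power) auto
      then show ?thesis using xT[of i] by eventually_elim (simp add: mom(4))
    qed
    show "AE \<omega> in W. nn_cond_exp W (F i) (\<lambda>\<omega>. ennreal (?Z (x i \<omega>, Y (Suc i) \<omega>) ^ 4)) \<omega> \<le> ennreal (B + C * x i \<omega> ^ 4)" for i
    proof -
      have "AE \<omega> in W. nn_cond_exp W (F i) (\<lambda>\<omega>. ennreal (?Z (x i \<omega>, Y (Suc i) \<omega>) ^ 4)) \<omega> =
         (\<integral>\<^sup>+y. ennreal (?Z (x i \<omega>, y) ^ 4) \<partial>model M p (x i \<omega>))"
        using Z
        by (intro nn_cond_exp_kernel[where T=\<Theta> and f="\<lambda>q. ennreal (?Z q ^ 4)", OF W sub x_F Y _ xT P cond])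
           (auto simp: model_def intro!: borel_measurable_power measurable_compose[OF _ measurable_ennreal])
      then show ?thesis using xT[of i]
      proof eventually_elim
        case (elim \<omega>)
        have "(\<integral>\<^sup>+y. ennreal (?Z (x i \<omega>, y) ^ 4) \<partial>model M p (x i \<omega>)) = ennreal (\<integral>y. scaled_score M \<Theta> p (x i \<omega>) y ^ 4 \<partial>model M p (x i \<omega>))"
          using four(1)[OF elim(2)] by (subst nn_integral_eq_integral) auto
        then show ?case using four(2)[OF elim(2)] elim(1) by (simp add: ennreal_leI)
      qed
    qed
  qed
  then show ?thesis by (simp add: F_def x_def[abs_def])
qed

theorem theorem2:
  fixes M :: "'y measure" and \<Theta> :: "real set" and p :: "real \<Rightarrow> 'y \<Rightarrow> real"
    and \<theta>star B C :: real and \<theta> :: "nat \<Rightarrow> real"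
    and W :: "nat \<Rightarrow> 'w measure" and Y :: "nat \<Rightarrow> nat \<Rightarrow> 'w \<Rightarrow> 'y"
  assumes "\<Theta> \<in> sets borel"
    and "(\<lambda>(t, y). p t y) \<in> borel_measurable (restrict_space borel \<Theta> \<Otimes>\<^sub>M M)"
    and "(\<lambda>(t, y). score \<Theta> p t y) \<in> borel_measurable (restrict_space borel \<Theta> \<Otimes>\<^sub>M M)"
    and "\<And>t y. t \<in> \<Theta> \<Longrightarrow> y \<in> space M \<Longrightarrow> 0 \<le> p t y"
    and "\<And>t. t \<in> \<Theta> \<Longrightarrow> prob_space (model M p t)"
    and "\<And>t. t \<in> \<Theta> \<Longrightarrow> AE y in model M p t. has_score \<Theta> p t y"
    and "\<And>t. t \<in> \<Theta> \<Longrightarrow> integrable (model M p t) (score \<Theta> p t)"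
    and "\<And>t. t \<in> \<Theta> \<Longrightarrow> (\<integral>y. score \<Theta> p t y \<partial>model M p t) = 0"
    and "\<And>t. t \<in> \<Theta> \<Longrightarrow> integrable (model M p t) (\<lambda>y. (score \<Theta> p t y)\<^sup>2)"
    and "\<And>t. t \<in> \<Theta> \<Longrightarrow> continuous (at t within \<Theta>) (fisher M \<Theta> p)"
    and "\<And>t. t \<in> \<Theta> \<Longrightarrow> fisher M \<Theta> p t > 0"
    and "\<theta>star \<in> \<Theta>"
    and "C1_near \<Theta> (\<lambda>t. inverse (fisher M \<Theta> p t)) \<theta>star"
    and "B \<ge> 0" and "C \<ge> 0"
    and "\<And>t. t \<in> \<Theta> \<Longrightarrow> integrable (model M p t) (\<lambda>y. (scaled_score M \<Theta> p t y) ^ 4)"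
    and "\<And>t. t \<in> \<Theta> \<Longrightarrow> (\<integral>y. (scaled_score M \<Theta> p t y) ^ 4 \<partial>model M p t) \<le> B + C * t ^ 4"
    and "\<And>n. n \<ge> 1 \<Longrightarrow> \<theta> n \<in> \<Theta>"
    and "\<theta> \<longlonglongrightarrow> \<theta>star"
    and "\<And>n. n \<ge> 1 \<Longrightarrow> predictive_resampling M \<Theta> p n (\<theta> n) (W n) (Y n)"
  shows "(\<forall>n\<ge>1. AE \<omega> in W n. convergent (iterate M \<Theta> p n (\<theta> n) (\<lambda>i. Y n i \<omega>))) \<and>
    weak_conv_m
      (\<lambda>n. distr (W n) borel
         (\<lambda>\<omega>. inverse (rate n) * (limit_iterate M \<Theta> p n (\<theta> n) (\<lambda>i. Y n i \<omega>) - \<theta> n)))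
      (density lborel (normal_density 0 (sqrt (inverse (fisher M \<Theta> p \<theta>star)))))"
proof -
  let ?x = "\<lambda>n i \<omega>. iterate M \<Theta> p n (\<theta> n) (\<lambda>j. Y n j \<omega>) i"
  let ?z = "\<lambda>n i \<omega>. scaled_score M \<Theta> p (?x n i \<omega>) (Y n (Suc i) \<omega>)"
  let ?g = "\<lambda>t. inverse (fisher M \<Theta> p t)"
  let ?L = "\<lambda>n \<omega>. limit_iterate M \<Theta> p n (\<theta> n) (\<lambda>i. Y n i \<omega>)"
  have row: "adapted_recursion (W n) (draws_algebra (W n) M (Y n)) (?x n) (?z n) ?g \<Theta> B C (\<theta> n) n" if "1 \<le> n" for n
    by (rule predictive_resampling_adapted_recursion[OF assms(1,3,5,7-11,14-17) that assms(20)[OF that]])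
  interpret adapted_recursion_array W "\<lambda>n. draws_algebra (W n) M (Y n)" ?x ?z ?g \<Theta> B C \<theta>star \<theta>
  proof (rule adapted_recursion_array.intro)
    \<comment> \<open>\<open>g\<close> inherits continuity from the information, which is positive
      at \<theta>star.\<close>
    show "continuous (at \<theta>star within \<Theta>) ?g"
      using assms(10,11)[OF assms(12)] by (intro continuous_at_within_inverse) auto
    show "0 < ?g \<theta>star" using assms(11)[OF assms(12)] by simp
  qed (fact row assms(12,19))+
  have conv: "AE \<omega> in W n. convergent (\<lambda>i. ?x n i \<omega>)" if "1 \<le> n" for n
    by (rule adapted_recursion.AE_convergent[OF row[OF that]])
  \<comment> \<open>\<open>lim\<close> is total, so measurability holds on the whole space,
    including the null set on which a row may diverge.\<close>
  have L: "?L n \<in> borel_measurable (W n)" if "1 \<le> n" for n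
    unfolding limit_iterate_def
    by (rule borel_measurable_lim_metric) (rule adapted_recursion.x_W[OF row[OF that]])
  have lim: "AE \<omega> in W n. (\<lambda>i. ?x n i \<omega>) \<longlonglongrightarrow> ?L n \<omega>" if "1 \<le> n" for n
    using conv[OF that] unfolding limit_iterate_def convergent_LIMSEQ_iff .
  show ?thesis using weak_convergence[OF L lim] conv by blast
qed

end
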